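(* Let $N\ge 1$ be an integer. For every $x\in\mathbb{R}$, $$|F(x)-F_N(x)| \le \eta_N(x) \le c_N\,\frac{e^{-\pi N}}{\sqrt{N+1/2}},$$ where $$c_N=\frac{20\sqrt2\,e^{-\pi/2}}{9\pi\left(1-e^{-2A_N^2}\right)}\left(1+2\sqrt\pi\,e^{-\beta A_N^2}\right)+\frac{(2\pi+1)e^{-\pi/2}}{2\sqrt2\,\pi^{3/2}A_N}.$$ Moreover $c_N$ decreases as $N$ increases, with $c_1\approx 0.825$ and $\lim_{N\to\infty}c_N=\dfrac{20\sqrt2\,e^{-\pi/2}}{9\pi}\approx 0.208$.
   Context: The Fresnel integral is $F(x):=\frac{e^{-i\pi/4}}{\sqrt\pi}\int_x^\infty e^{it^2}\,dt$ for $x\in\mathbb{R}$ (improper integral). For an integer $N\ge1$ put $A_N:=\sqrt{(N+1/2)\pi}$ and $t_k:=\frac{(k-1/2)\pi}{\sqrt{(N+1/2)\pi}}$, and define $$F_N(x):=\frac{1}{\exp\left(2A_Nxe^{-i\pi/4}\right)+1}+\frac{x}{A_N}e^{i(x^2+\pi/4)}\sum_{k=1}^N\frac{e^{-t_k^2}}{x^2+it_k^2}.$$ Let $\beta:=1-\frac{\sqrt2}{2}-\frac{2\sqrt2+1}{16}\approx 0.0536$. For $x\ge0$ define $$\Delta(x):=\begin{cases}\dfrac{x\,e^{-A_N^2}}{\sqrt\pi\,(A_N^2-x^2/2)\,(1-e^{-2A_N^2})}, & 0\le \frac{x}{\sqrt2}\le\frac34A_N,\\[2mm] \dfrac{4x\,e^{-A_N^2}\left(1+2\sqrt\pi\,e^{-\beta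 A_N^2}\right)}{\sqrt\pi\,A_N(A_N+x/\sqrt2)\,(1-e^{-2A_N^2})}, & \frac34A_N<\frac{x}{\sqrt2}<\frac54A_N,\\[2mm] \dfrac{x\,e^{-A_N^2}}{\sqrt\pi\,(x^2/2-A_N^2)\,(1-e^{-2A_N^2})}+\dfrac{e^{-\sqrt2A_Nx}}{1-e^{-\sqrt2A_Nx}}, & \frac{x}{\sqrt2}\ge\frac54A_N,\end{cases}$$ and for $x\in\mathbb{R}$ define $$\eta_N(x):=\Delta(|x|)+\frac{(2\pi+1)|x|}{2\pi A_N\sqrt{x^4+A_N^4}}\,e^{-A_N^2}.$$ *)

theory Defs
  imports "HOL-Analysis.Analysis"
begin

text \<open>The integral over the half-line is improper (conditionally convergent), hence a limit of
  integrals over compact intervals rather than a Lebesgue integral.\<close>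

definition fresnel_F :: "real \<Rightarrow> complex" where
  "fresnel_F x =
     exp (- \<i> * of_real pi / 4) / of_real (sqrt pi) *
     Lim at_top (\<lambda>T. integral {x..T} (\<lambda>t. exp (\<i> * of_real (t\<^sup>2))))"

definition A :: "nat \<Rightarrow> real" where
  "A N = sqrt ((real N + 1/2) * pi)"

definition node :: "nat \<Rightarrow> nat \<Rightarrow> real" where
  "node N k = (real k - 1/2) * pi / sqrt ((real N + 1/2) * pi)"

definition fresnel_approx :: "nat \<Rightarrow> real \<Rightarrow> complex" where
  "fresnel_approx N x =
     1 / (exp (2 * of_real (A N) * of_real x * exp (- \<i> * of_real pi / 4)) + 1)
     + of_real (x / A N) * exp (\<i> * of_real (x\<^sup>2 + pi / 4)) *
       (\<Sum>k=1..N. of_real (exp (- (node N k)\<^sup>2)) /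
                   (of_real (x\<^sup>2) + \<i> * of_real ((node N k)\<^sup>2)))"

definition beta :: real where
  "beta = 1 - sqrt 2 / 2 - (2 * sqrt 2 + 1) / 16"

text \<open>Only the values at nonnegative arguments are meaningful.\<close>

definition Delta :: "nat \<Rightarrow> real \<Rightarrow> real" where
  "Delta N x =
     (if x / sqrt 2 \<le> 3/4 * A N then
        x * exp (- (A N)\<^sup>2) /
        (sqrt pi * ((A N)\<^sup>2 - x\<^sup>2 / 2) * (1 - exp (- 2 * (A N)\<^sup>2)))
      else if x / sqrt 2 < 5/4 * A N then
        4 * x * exp (- (A N)\<^sup>2) * (1 + 2 * sqrt pi * exp (- beta * (A N)\<^sup>2)) /
        (sqrt pi * A N * (A N + x / sqrt 2) * (1 - exp (- 2 * (A N)\<^sup>2)))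
      else
        x * exp (- (A N)\<^sup>2) /
        (sqrt pi * (x\<^sup>2 / 2 - (A N)\<^sup>2) * (1 - exp (- 2 * (A N)\<^sup>2)))
        + exp (- sqrt 2 * A N * x) / (1 - exp (- sqrt 2 * A N * x)))"

definition eta :: "nat \<Rightarrow> real \<Rightarrow> real" where
  "eta N x =
     Delta N \<bar>x\<bar>
     + (2 * pi + 1) * \<bar>x\<bar> / (2 * pi * A N * sqrt (x^4 + (A N)^4)) * exp (- (A N)\<^sup>2)"

definition c :: "nat \<Rightarrow> real" where
  "c N =
     20 * sqrt 2 * exp (- pi / 2) / (9 * pi * (1 - exp (- 2 * (A N)\<^sup>2)))
       * (1 + 2 * sqrt pi * exp (- beta * (A N)\<^sup>2))
     + (2 * pi + 1) * exp (- pi / 2) / (2 * sqrt 2 * pi powr (3/2) * A N)"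

end

theory Submission
  imports Defs "HOL-Complex_Analysis.Complex_Analysis" "HOL-Probability.Distributions"
begin

text \<open>
  Write \<open>\<alpha> = A N\<close>, \<open>h = \<pi>/\<alpha>\<close>, and \<open>f(z) = exp(-z\<^sup>2)/(x\<^sup>2 + \<i> z\<^sup>2)\<close>.  For \<open>x > 0\<close> the Fresnel integral is
  \<open>F(x) = x/(2\<pi>) exp(\<i>(x\<^sup>2 + \<pi>/4)) \<integral> f\<close>, the integral over the whole real line
  (\<open>fresnel_F_eq_whole_line_integral\<close>), and the sum in \<open>F\<^sub>N\<close> is the midpoint rule of step \<open>h\<close> for this
  integral, cut off after \<open>N\<close> terms.  The nodes \<open>t\<^sub>k = (k - 1/2) h\<close> are the poles of
  \<open>g(z) = 1/(1 + exp(-2\<i>\<alpha> z))\<close>, at which \<open>f g\<close> has residue \<open>f(t\<^sub>k)/(2\<i>\<alpha>)\<close>.  The residue theorem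
  on a strip around the real line, combined with \<open>f(-z) = f(z)\<close> and \<open>g(-z) = 1 - g(z)\<close>, therefore gives
  \<open>\<integral> f - h \<Sum> f(t\<^sub>k) = 2 \<integral> f g\<close> with the last integral along a line \<open>Im z = H\<close>
  (\<open>quadrature_identity\<close>).

  On that line \<open>|exp(-z\<^sup>2) g(z)|\<close> is about \<open>exp(H\<^sup>2 - 2\<alpha>H - (Re z)\<^sup>2)\<close>; the factor
  \<open>exp(H\<^sup>2 - 2\<alpha>H)\<close> is smallest at \<open>H = \<alpha>\<close>, where
  it is \<open>exp(-\<alpha>\<^sup>2)\<close>; so the line is moved up to \<open>Im z = \<alpha>\<close>.  The only obstacle is the pole of \<open>f\<close> at
  \<open>z\<^sub>0 = x exp(\<i>\<pi>/4)\<close>, at height \<open>x/\<surd>2\<close>.  The three branches of \<open>Delta\<close> are the three positions of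
  that pole.  Well below \<open>\<alpha>\<close> it is crossed, and its residue is exactly the correction
  \<open>1/(exp(2\<alpha>x exp(-\<i>\<pi>/4)) + 1)\<close> in \<open>F\<^sub>N\<close> (\<open>quadrature_defect_pole_below\<close>).  Well above, it is not
  crossed, and the correction term is itself part of the error (\<open>quadrature_defect_pole_above\<close>).  Near
  \<open>\<alpha>\<close> the contour makes a rectangular detour over the pole; on the detour \<open>Re z\<close> is comparable to
  \<open>\<alpha>\<close>, so \<open>exp(-z\<^sup>2)\<close> supplies an extra exponentially small factor (\<open>quadrature_defect_pole_near\<close>).

  The nodes beyond \<open>t\<^sub>N\<close> start at \<open>t\<^sub>N\<^sub>+\<^sub>1 = \<alpha>\<close>, so dropping them costs about \<open>exp(-\<alpha>\<^sup>2)\<close> again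
  (\<open>fresnel_tail_le\<close>); this is the last term of \<open>eta\<close>.  The value \<open>F(0) = 1/2\<close> follows by letting
  \<open>x \<rightarrow> 0\<close> in the bound for positive \<open>x\<close>, and negative \<open>x\<close> from \<open>F(-x) = 1 - F(x)\<close>, which
  \<open>F\<^sub>N\<close> satisfies as well.  The uniform bound on \<open>eta\<close> maximises each branch separately, and the
  numerical claims come from Taylor bounds for the exponential.
\<close>

section \<open>The Gaussian integral\<close>

lemma gaussian_has_integral: "((\<lambda>t::real. exp (- t\<^sup>2)) has_integral sqrt pi) UNIV"
proof -
  have "has_bochner_integral lborel (\<lambda>t::real. exp (- t\<^sup>2)) (2 *\<^sub>R (sqrt pi / 2))"
    by (rule has_bochner_integral_even_function[OF gaussian_moment_0]) simp
  then show ?thesis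
    using has_integral_integral_lborel[of "\<lambda>t::real. exp (- t\<^sup>2)"]
    by (simp add: has_bochner_integral_iff)
qed

lemma gaussian_integrable: "(\<lambda>t::real. exp (- t\<^sup>2)) integrable_on {a..b}"
  by (intro integrable_continuous_interval continuous_intros)

lemma gaussian_interval_le: "integral {a..b} (\<lambda>t::real. exp (- t\<^sup>2)) \<le> sqrt pi"
  using integral_subset_le[of "{a..b}" UNIV "\<lambda>t::real. exp (- t\<^sup>2)"] gaussian_integrable[of a b]
    gaussian_has_integral
  by (auto simp: has_integral_iff)

text \<open>Every integral over the line is later met as the limit of integrals over \<open>{-R..R}\<close>, because the
  residue theorem only sees finite rectangles.\<close>

lemma tendsto_integral_symmetric:
  fixes f :: "real \<Rightarrow> 'a :: banach"
  assumes "(f has_integral I) UNIV"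
  shows "((\<lambda>R. integral {-R..R} f) \<longlongrightarrow> I) at_top"
proof (rule tendstoI)
  fix e :: real assume "e > 0"
  with assms obtain B where "B > 0" and
    B: "\<And>a b. ball 0 B \<subseteq> cbox a b \<Longrightarrow> norm (integral (cbox a b) f - I) < e"
    unfolding has_integral_alt' by auto
  show "\<forall>\<^sub>F R in at_top. dist (integral {-R..R} f) I < e"
    using eventually_ge_at_top[of B]
  proof eventually_elim
    case (elim R)
    have "ball 0 B \<subseteq> cbox (-R) R"
      using elim by (auto simp: dist_norm)
    from B[OF this] show ?case by (simp add: dist_norm)
  qed
qed

section \<open>The integral representation\<close>

definition integrand :: "real \<Rightarrow> complex \<Rightarrow> complex" where
  "integrand x z = exp (- z\<^sup>2) / (of_real (x\<^sup>2) + \<i> * z\<^sup>2)"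

lemma square_plus_i_square_nz:
  assumes "x > (0::real)"
  shows "(of_real x)\<^sup>2 + \<i> * (of_real (t::real))\<^sup>2 \<noteq> (0::complex)"
proof
  assume "(of_real x)\<^sup>2 + \<i> * (of_real t)\<^sup>2 = (0::complex)"
  then have "Re ((of_real x)\<^sup>2 + \<i> * (of_real t)\<^sup>2) = 0" by simp
  then show False using assms
    by (simp add: Re_power2)
qed

lemma norm_square_plus_i_square:
  "norm ((of_real x)\<^sup>2 + \<i> * (of_real t)\<^sup>2 :: complex) = sqrt (x^4 + t^4)"
  by (simp add: cmod_def Re_power2 Im_power2 flip: power_mult)

lemma norm_square_plus_i_square_ge:
  "x\<^sup>2 \<le> norm ((of_real x)\<^sup>2 + \<i> * (of_real t)\<^sup>2 :: complex)"
  "t\<^sup>2 \<le> norm ((of_real x)\<^sup>2 + \<i> * (of_real t)\<^sup>2 :: complex)"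
  unfolding norm_square_plus_i_square by (auto intro!: real_le_rsqrt simp flip: power_mult)

lemma norm_integrand_real_le:
  assumes "x > 0"
  shows "norm (integrand x (of_real t)) \<le> exp (- t\<^sup>2) / x\<^sup>2"
proof -
  have "norm (integrand x (of_real t)) = exp (- t\<^sup>2) / norm ((of_real x)\<^sup>2 + \<i> * (of_real t)\<^sup>2 :: complex)"
    by (simp add: integrand_def norm_divide Re_power2)
  also have "\<dots> \<le> exp (- t\<^sup>2) / x\<^sup>2"
    using assms norm_square_plus_i_square_ge(1)[of x t]
    by (intro divide_left_mono) (auto intro!: mult_pos_pos simp: square_plus_i_square_nz)
  finally show ?thesis .
qed

lemma continuous_integrand_real:
  assumes "x > 0"
  shows "continuous_on S (\<lambda>t::real. integrand x (of_real t))"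
  unfolding integrand_def using square_plus_i_square_nz[OF assms]
  by (intro continuous_intros) auto

lemma integrand_integrable_UNIV:
  assumes "x > 0"
  shows "(\<lambda>t::real. integrand x (of_real t)) integrable_on UNIV"
proof (rule integrable_on_all_intervals_integrable_bound[where g="\<lambda>t. exp (- t\<^sup>2) / x\<^sup>2"])
  show "(\<lambda>t. if t \<in> UNIV then integrand x (complex_of_real t) else 0) integrable_on cbox a b" for a b
    using continuous_integrand_real[OF assms] by (auto intro!: integrable_continuous_interval)
  show "(\<lambda>t::real. exp (- t\<^sup>2) / x\<^sup>2) integrable_on UNIV"
    using gaussian_has_integral by (intro integrable_on_divide) auto
qed (use norm_integrand_real_le[OF assms] in auto)

definition whole_line_integral :: "real \<Rightarrow> complex" where
  "whole_line_integral x = integral UNIV (\<lambda>t::real. integrand x (of_real t))"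

lemma tendsto_whole_line_integral:
  assumes "x > 0"
  shows "((\<lambda>R. integral {-R..R} (\<lambda>t. integrand x (of_real t))) \<longlongrightarrow> whole_line_integral x) at_top"
  unfolding whole_line_integral_def
  by (intro tendsto_integral_symmetric integrable_integral integrand_integrable_UNIV assms)

lemma norm_whole_line_integral_le:
  assumes "x > 0"
  shows "norm (whole_line_integral x) \<le> sqrt pi / x\<^sup>2"
  unfolding whole_line_integral_def
proof (rule order_trans[OF integral_norm_bound_integral])
  show "(\<lambda>t::real. exp (- t\<^sup>2) / x\<^sup>2) integrable_on UNIV"
    using gaussian_has_integral by (intro integrable_on_divide) auto
  show "integral UNIV (\<lambda>t. exp (- t\<^sup>2) / x\<^sup>2) \<le> sqrt pi / x\<^sup>2"
    using gaussian_has_integral by (simp add: has_integral_iff)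
qed (use norm_integrand_real_le[OF assms] integrand_integrable_UNIV[OF assms] in auto)

text \<open>With \<open>q(w, t) = w exp(\<i>w\<^sup>2 - t\<^sup>2) / (w\<^sup>2 + \<i>t\<^sup>2)\<close>, the flux \<open>(t/w) q(w, t)\<close> turns differentiation in
  \<open>w\<close> into a total derivative in \<open>t\<close>:  \<open>\<partial>q/\<partial>w = 2\<i> exp(\<i>w\<^sup>2) exp(-t\<^sup>2) - \<partial>flux/\<partial>t\<close>.  After
  integration over \<open>t\<close> only the Gaussian survives, up to boundary terms, and the right-hand side
  becomes a multiple of the Fresnel integrand \<open>exp(\<i>w\<^sup>2)\<close>.\<close>

definition flux :: "complex \<Rightarrow> real \<Rightarrow> complex" where
  "flux w t = of_real t * exp (\<i> * w\<^sup>2 - of_real (t\<^sup>2)) / (w\<^sup>2 + \<i> * (of_real t)\<^sup>2)"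

definition flux_deriv :: "complex \<Rightarrow> real \<Rightarrow> complex" where
  "flux_deriv w t = exp (\<i> * w\<^sup>2 - of_real (t\<^sup>2)) *
     ((1 - 2 * (of_real t)\<^sup>2) / (w\<^sup>2 + \<i> * (of_real t)\<^sup>2)
       - 2 * \<i> * (of_real t)\<^sup>2 / (w\<^sup>2 + \<i> * (of_real t)\<^sup>2)\<^sup>2)"

lemma flux_has_derivative:
  assumes "x > (0::real)"
  shows "((\<lambda>t. flux (of_real x) t) has_vector_derivative flux_deriv (of_real x) t) (at t within S)"
proof -
  define w where "w = complex_of_real x"
  have nz: "w\<^sup>2 + \<i> * (of_real t)\<^sup>2 \<noteq> 0"
    using square_plus_i_square_nz[OF assms] by (simp add: w_def)
  have "((\<lambda>u. u * exp (\<i> * w\<^sup>2 - u\<^sup>2) / (w\<^sup>2 + \<i> * u\<^sup>2)) has_field_derivative flux_deriv w t)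
     (at (of_real t))"
    apply (rule derivative_eq_intros refl nz | simp)+
    using nz unfolding flux_deriv_def
    apply (simp add: divide_simps)
    apply (simp add: power2_eq_square algebra_simps)
    done
  from has_vector_derivative_real_field[OF this] show ?thesis
    by (simp add: flux_def[abs_def] w_def)
qed

lemma fresnel_kernel_has_derivative:
  assumes "x > (0::real)"
  shows "((\<lambda>x. of_real x * exp (\<i> * (of_real x)\<^sup>2) * integrand x (of_real t)) has_vector_derivative
     (2 * \<i> * exp (\<i> * (of_real x)\<^sup>2) * exp (- (of_real t)\<^sup>2) - flux_deriv (of_real x) t)) (at x within S)"
proof -
  define w where "w = complex_of_real x"
  have nz: "w\<^sup>2 + \<i> * (of_real t)\<^sup>2 \<noteq> 0"
    using square_plus_i_square_nz[OF assms] by (simp add: w_def)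
  have "((\<lambda>w. w * exp (\<i> * w\<^sup>2) * (exp (- (of_real t)\<^sup>2) / (w\<^sup>2 + \<i> * (of_real t)\<^sup>2))) has_field_derivative
     (2 * \<i> * exp (\<i> * w\<^sup>2) * exp (- (of_real t)\<^sup>2) - flux_deriv w t)) (at w)"
    apply (rule derivative_eq_intros refl nz | simp)+
    using nz unfolding flux_deriv_def
    apply (simp add: divide_simps exp_diff exp_minus)
    apply (simp add: power2_eq_square algebra_simps)
    done
  then have "((\<lambda>w. w * exp (\<i> * w\<^sup>2) * (exp (- (of_real t)\<^sup>2) / (w\<^sup>2 + \<i> * (of_real t)\<^sup>2))) has_field_derivative
     (2 * \<i> * exp (\<i> * w\<^sup>2) * exp (- (of_real t)\<^sup>2) - flux_deriv w t)) (at (of_real x))"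
    by (simp add: w_def)
  from has_vector_derivative_real_field[OF this] show ?thesis
    by (simp add: integrand_def[abs_def] w_def)
qed

text \<open>Differentiation under the integral sign is applied to the truncation to \<open>{-R..R}\<close>, where it needs
  only continuity on a compact box; the limit \<open>R \<rightarrow> \<infinity>\<close> is taken after integrating back in \<open>x\<close>.\<close>

definition truncated_fresnel :: "real \<Rightarrow> real \<Rightarrow> complex" where
  "truncated_fresnel R x = of_real x * exp (\<i> * (of_real x)\<^sup>2) * integral {-R..R} (\<lambda>t. integrand x (of_real t))"

lemma flux_minus: "flux w (- R) = - flux w R"
  by (simp add: flux_def)

lemma truncated_fresnel_has_derivative:
  assumes "0 < x0" "x \<in> {x0..T}" "R > 0"
  shows "(truncated_fresnel R has_vector_derivative
     (2 * \<i> * exp (\<i> * (of_real x)\<^sup>2) * of_real (integral {-R..R} (\<lambda>t. exp (- t\<^sup>2))) - 2 * flux (of_real x) R))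
     (at x within {x0..T})"
proof -
  let ?d = "\<lambda>(x::real) (t::real). 2 * \<i> * exp (\<i> * (of_real x)\<^sup>2) * exp (- (of_real t)\<^sup>2) - flux_deriv (of_real x) t"
  let ?q = "\<lambda>(x::real) (t::real). of_real x * exp (\<i> * (of_real x)\<^sup>2) * integrand x (of_real t)"
  have Q: "truncated_fresnel R = (\<lambda>x. integral (cbox (-R) R) (?q x))"
    by (simp add: truncated_fresnel_def fun_eq_iff)
  have xp: "x > 0" using assms by auto
  have "((\<lambda>x. integral (cbox (-R) R) (?q x)) has_vector_derivative integral (cbox (-R) R) (?d x))
     (at x within {x0..T})"
  proof (rule leibniz_rule_vector_derivative)
    show "((\<lambda>x. ?q x t) has_vector_derivative ?d y t) (at y within {x0..T})" if "y \<in> {x0..T}" for y t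
      using that assms by (intro fresnel_kernel_has_derivative) auto
    show "?q y integrable_on cbox (-R) R" if "y \<in> {x0..T}" for y
      using that assms
      by (intro integrable_continuous continuous_intros continuous_integrand_real) auto
    show "continuous_on ({x0..T} \<times> cbox (-R) R) (\<lambda>(x, t). ?d x t)"
      unfolding flux_deriv_def split_beta using assms(1)
      by (intro continuous_intros) (auto simp: square_plus_i_square_nz)
  qed (use assms in auto)
  moreover have "((\<lambda>t. ?d x t) has_integral
     (2 * \<i> * exp (\<i> * (of_real x)\<^sup>2) * of_real (integral {-R..R} (\<lambda>t. exp (- t\<^sup>2)))
       - (flux (of_real x) R - flux (of_real x) (-R)))) {-R..R}"
  proof (intro has_integral_diff has_integral_mult_right)
    have "((\<lambda>t. complex_of_real (exp (- t\<^sup>2))) has_integral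
        of_real (integral {-R..R} (\<lambda>t. exp (- t\<^sup>2)))) {-R..R}"
      using gaussian_integrable by (intro has_integral_of_real integrable_integral)
    then show "((\<lambda>t. exp (- (complex_of_real t)\<^sup>2)) has_integral
        of_real (integral {-R..R} (\<lambda>t. exp (- t\<^sup>2)))) {-R..R}"
      by (simp flip: exp_of_real)
    show "(flux_deriv (of_real x) has_integral (flux (of_real x) R - flux (of_real x) (-R))) {-R..R}"
      using assms by (intro fundamental_theorem_of_calculus flux_has_derivative[OF xp]) auto
  qed
  ultimately show ?thesis
    unfolding Q by (simp add: integral_unique flux_minus)
qed

lemma norm_flux_le:
  assumes "x > 0" "R > 0"
  shows "norm (flux (of_real x) R) \<le> exp (- R\<^sup>2) / R"
proof -
  have "norm (flux (of_real x) R) = R * exp (- R\<^sup>2) / norm ((of_real x)\<^sup>2 + \<i> * (of_real R)\<^sup>2 :: complex)"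
    using assms by (simp add: flux_def norm_divide norm_mult Im_power2 Re_power2)
  also have "\<dots> \<le> R * exp (- R\<^sup>2) / R\<^sup>2"
    using assms norm_square_plus_i_square_ge(2)[of R x]
    by (intro divide_left_mono) (auto intro!: mult_pos_pos simp: square_plus_i_square_nz)
  also have "\<dots> = exp (- R\<^sup>2) / R"
    using assms by (simp add: power2_eq_square)
  finally show ?thesis .
qed

lemma chirp_integrable: "(\<lambda>t::real. exp (\<i> * of_real (t\<^sup>2))) integrable_on {a..b}"
  by (intro integrable_continuous_interval continuous_intros)

lemma truncated_fresnel_increment:
  assumes "0 < x" "x \<le> T" "R > 0"
  shows "norm (truncated_fresnel R T - truncated_fresnel R x
      - 2 * \<i> * of_real (integral {-R..R} (\<lambda>t. exp (- t\<^sup>2))) * integral {x..T} (\<lambda>t. exp (\<i> * of_real (t\<^sup>2))))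
    \<le> 2 * exp (- R\<^sup>2) / R * (T - x)"
proof -
  let ?E = "complex_of_real (integral {-R..R} (\<lambda>t. exp (- t\<^sup>2)))"
  have 1: "((\<lambda>y. 2 * \<i> * exp (\<i> * (of_real y)\<^sup>2) * ?E - 2 * flux (of_real y) R)
     has_integral (truncated_fresnel R T - truncated_fresnel R x)) {x..T}"
    using assms by (intro fundamental_theorem_of_calculus truncated_fresnel_has_derivative) auto
  have 2: "((\<lambda>y. 2 * \<i> * ?E * exp (\<i> * of_real (y\<^sup>2))) has_integral
     2 * \<i> * ?E * integral {x..T} (\<lambda>t. exp (\<i> * of_real (t\<^sup>2)))) {x..T}"
    by (intro has_integral_mult_right integrable_integral chirp_integrable)
  have 3: "((\<lambda>y. - 2 * flux (of_real y) R) has_integral (truncated_fresnel R T - truncated_fresnel R x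
      - 2 * \<i> * ?E * integral {x..T} (\<lambda>t. exp (\<i> * of_real (t\<^sup>2))))) (cbox x T)"
    using has_integral_diff[OF 1 2] by (simp add: algebra_simps)
  have "norm (truncated_fresnel R T - truncated_fresnel R x
      - 2 * \<i> * ?E * integral {x..T} (\<lambda>t. exp (\<i> * of_real (t\<^sup>2))))
     \<le> 2 * exp (- R\<^sup>2) / R * measure lborel (cbox x T)"
    using assms norm_flux_le by (intro has_integral_bound[OF _ 3]) (auto simp: norm_mult field_simps)
  then show ?thesis using assms by simp
qed

definition fresnel_transform :: "real \<Rightarrow> complex" where
  "fresnel_transform x = of_real x * exp (\<i> * (of_real x)\<^sup>2) * whole_line_integral x"

text \<open>Both sides are limits as \<open>R \<rightarrow> \<infinity>\<close> of the truncated quantities, the flux through the ends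
  \<open>t = \<plusminus>R\<close> being of size \<open>exp(-R\<^sup>2)/R\<close> uniformly in the interval of integration.\<close>

lemma fresnel_transform_increment:
  assumes "0 < x" "x \<le> T"
  shows "fresnel_transform T - fresnel_transform x =
     2 * \<i> * of_real (sqrt pi) * integral {x..T} (\<lambda>t. exp (\<i> * of_real (t\<^sup>2)))"
proof -
  let ?I = "integral {x..T} (\<lambda>t. exp (\<i> * complex_of_real (t\<^sup>2)))"
  let ?D = "\<lambda>R. truncated_fresnel R T - truncated_fresnel R x
      - 2 * \<i> * of_real (integral {-R..R} (\<lambda>t. exp (- t\<^sup>2))) * ?I"
  have "(?D \<longlongrightarrow> fresnel_transform T - fresnel_transform x - 2 * \<i> * of_real (sqrt pi) * ?I) at_top"
    unfolding truncated_fresnel_def fresnel_transform_def using assms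
    by (intro tendsto_intros tendsto_whole_line_integral tendsto_integral_symmetric
        gaussian_has_integral) auto
  moreover have "(?D \<longlongrightarrow> 0) at_top"
  proof (rule Lim_null_comparison)
    show "\<forall>\<^sub>F R in at_top. norm (?D R) \<le> 2 * exp (- R\<^sup>2) / R * (T - x)"
      using eventually_gt_at_top[of 0]
      by eventually_elim (use truncated_fresnel_increment assms in auto)
    show "((\<lambda>R::real. 2 * exp (- R\<^sup>2) / R * (T - x)) \<longlongrightarrow> 0) at_top"
      by real_asymp
  qed
  ultimately show ?thesis
    using tendsto_unique trivial_limit_at_top_linorder by fastforce
qed

lemma tendsto_fresnel_transform: "(fresnel_transform \<longlongrightarrow> 0) at_top"
proof (rule Lim_null_comparison)
  show "\<forall>\<^sub>F x in at_top. norm (fresnel_transform x) \<le> sqrt pi / x"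
    using eventually_gt_at_top[of 0]
  proof eventually_elim
    case (elim x)
    have "norm (fresnel_transform x) = x * norm (whole_line_integral x)"
      using elim by (simp add: fresnel_transform_def norm_mult Im_power2 Re_power2)
    also have "\<dots> \<le> x * (sqrt pi / x\<^sup>2)"
      using elim norm_whole_line_integral_le by (intro mult_left_mono) auto
    finally show ?case using elim by (simp add: power2_eq_square)
  qed
  show "((\<lambda>x. sqrt pi / x) \<longlongrightarrow> 0) at_top"
    by (intro tendsto_divide_0[OF tendsto_const] filterlim_at_top_imp_at_infinity filterlim_ident)
qed

lemma cis_quarter_sq: "exp (\<i> * of_real pi / 4) * exp (\<i> * of_real pi / 4) = \<i>"
proof -
  have "exp (\<i> * of_real pi / 4) * exp (\<i> * of_real pi / 4) = cis (pi / 2)"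
    by (simp add: cis_conv_exp flip: exp_add)
  then show ?thesis by simp
qed

text \<open>Convergence of the improper integral is obtained together with its value: the transform tends to
  \<open>0\<close> at infinity, so its increments determine the limit.\<close>

lemma tendsto_chirp_integral:
  assumes "x > 0"
  shows "((\<lambda>T. integral {x..T} (\<lambda>t. exp (\<i> * of_real (t\<^sup>2)))) \<longlongrightarrow>
     \<i> / (2 * of_real (sqrt pi)) * fresnel_transform x) at_top"
proof (rule Lim_transform_eventually)
  show "((\<lambda>T. (fresnel_transform T - fresnel_transform x) / (2 * \<i> * of_real (sqrt pi))) \<longlongrightarrow>
     \<i> / (2 * of_real (sqrt pi)) * fresnel_transform x) at_top"
    by (rule tendsto_eq_intros tendsto_fresnel_transform refl | simp add: divide_simps)+
  show "\<forall>\<^sub>F T in at_top. (fresnel_transform T - fresnel_transform x) / (2 * \<i> * of_real (sqrt pi)) =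
     integral {x..T} (\<lambda>t. exp (\<i> * of_real (t\<^sup>2)))"
    using eventually_ge_at_top[of x]
    by eventually_elim (use assms in \<open>simp add: fresnel_transform_increment\<close>)
qed

lemma exp_minus_quarter: "exp (- \<i> * of_real pi / 4) = exp (\<i> * of_real pi / 4) / \<i>"
  using cis_quarter_sq by (simp add: exp_minus field_simps)

theorem fresnel_F_eq_whole_line_integral:
  assumes "x > 0"
  shows "fresnel_F x = of_real (x / (2 * pi)) * exp (\<i> * of_real (x\<^sup>2 + pi / 4)) * whole_line_integral x"
proof -
  have "fresnel_F x = exp (- \<i> * of_real pi / 4) / of_real (sqrt pi) *
      (\<i> / (2 * of_real (sqrt pi)) * fresnel_transform x)"
    unfolding fresnel_F_def using tendsto_Lim[OF _ tendsto_chirp_integral[OF assms]] by simp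
  also have "\<dots> = exp (\<i> * of_real pi / 4) * fresnel_transform x / (2 * (of_real (sqrt pi) * of_real (sqrt pi)))"
    unfolding exp_minus_quarter by (simp add: field_simps)
  also have "complex_of_real (sqrt pi) * of_real (sqrt pi) = of_real pi"
    by (simp flip: of_real_mult)
  finally show ?thesis
    by (simp add: fresnel_transform_def distrib_left exp_add mult_ac)
qed

section \<open>Integrals over rectangles\<close>

text \<open>Contour integrals along the sides of a rectangle are expressed as real integrals, the factor
  \<open>\<i>\<close> of a vertical side being kept outside, so that sides can be split, reflected and
  estimated directly.\<close>

definition hline :: "(complex \<Rightarrow> complex) \<Rightarrow> real \<Rightarrow> real \<Rightarrow> real \<Rightarrow> complex" where
  "hline \<phi> y s t = integral {s..t} (\<lambda>\<sigma>. \<phi> (Complex \<sigma> y))"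

definition vline :: "(complex \<Rightarrow> complex) \<Rightarrow> real \<Rightarrow> real \<Rightarrow> real \<Rightarrow> complex" where
  "vline \<phi> s y y' = integral {y..y'} (\<lambda>\<eta>. \<phi> (Complex s \<eta>))"

definition rect_integral :: "(complex \<Rightarrow> complex) \<Rightarrow> real \<Rightarrow> real \<Rightarrow> real \<Rightarrow> real \<Rightarrow> complex" where
  "rect_integral \<phi> s t y y' =
     hline \<phi> y s t + \<i> * vline \<phi> t y y' - hline \<phi> y' s t - \<i> * vline \<phi> s y y'"

lemma contour_integral_linepath_horizontal:
  assumes "s < t"
  shows "contour_integral (linepath (Complex s y) (Complex t y)) \<phi> = hline \<phi> y s t"
proof -
  have eq: "linepath (Complex s y) (Complex t y) u = linepath (of_real s) (of_real t) u + \<i> * of_real y" for u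
    by (simp add: linepath_def complex_eq_iff algebra_simps)
  have "contour_integral (linepath (Complex s y) (Complex t y)) \<phi> =
      contour_integral (linepath (of_real s) (of_real t)) (\<lambda>z. \<phi> (z + \<i> * of_real y))"
    by (simp add: contour_integral_integral eq) (simp add: Complex_eq)
  also have "\<dots> = hline \<phi> y s t"
    unfolding hline_def using assms
    by (subst contour_integral_linepath_Reals_eq) (auto simp: Complex_eq)
  finally show ?thesis .
qed

lemma contour_integral_rectpath:
  assumes "s < t" "y < y'" and cont: "continuous_on (path_image (rectpath (Complex s y) (Complex t y'))) \<phi>"
  shows "contour_integral (rectpath (Complex s y) (Complex t y')) \<phi> = rect_integral \<phi> s t y y'"
proof -
  let ?a = "Complex s y" and ?b = "Complex t y" and ?c = "Complex t y'" and ?d = "Complex s y'"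
  have im: "path_image (rectpath ?a ?c) =
      closed_segment ?a ?b \<union> closed_segment ?b ?c \<union> closed_segment ?c ?d \<union> closed_segment ?d ?a"
    by (simp add: rectpath_def Let_def path_image_join Un_assoc)
  have c: "continuous_on (closed_segment ?a ?b) \<phi>" "continuous_on (closed_segment ?b ?c) \<phi>"
     "continuous_on (closed_segment ?c ?d) \<phi>" "continuous_on (closed_segment ?d ?a) \<phi>"
    by (rule continuous_on_subset[OF cont]; auto simp: im)+
  have "contour_integral (rectpath ?a ?c) \<phi> =
      contour_integral (linepath ?a ?b) \<phi> + contour_integral (linepath ?b ?c) \<phi>
      + contour_integral (linepath ?c ?d) \<phi> + contour_integral (linepath ?d ?a) \<phi>"
    using c by (simp add: rectpath_def Let_def contour_integrable_continuous_linepath contour_integrable_joinI)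
  also have "contour_integral (linepath ?c ?d) \<phi> = - contour_integral (linepath ?d ?c) \<phi>"
    using c by (simp add: contour_integral_reverse_linepath)
  also have "contour_integral (linepath ?d ?a) \<phi> = - contour_integral (linepath ?a ?d) \<phi>"
    using c by (simp add: contour_integral_reverse_linepath)
  also have "contour_integral (linepath ?a ?b) \<phi> = hline \<phi> y s t"
    by (rule contour_integral_linepath_horizontal[OF assms(1)])
  also have "contour_integral (linepath ?d ?c) \<phi> = hline \<phi> y' s t"
    by (rule contour_integral_linepath_horizontal[OF assms(1)])
  also have "contour_integral (linepath ?b ?c) \<phi> = \<i> * vline \<phi> t y y'"
    unfolding vline_def using assms by (subst contour_integral_linepath_same_Re) auto
  also have "contour_integral (linepath ?a ?d) \<phi> = \<i> * vline \<phi> s y y'"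
    unfolding vline_def using assms by (subst contour_integral_linepath_same_Re) auto
  finally show ?thesis by (simp add: rect_integral_def)
qed

lemma rect_integral_residues:
  assumes "s < t" "y < y'" and S: "open S" "connected S"
    and pts: "finite pts" "pts \<subseteq> box (Complex s y) (Complex t y')"
    and sub: "cbox (Complex s y) (Complex t y') \<subseteq> S"
    and holo: "\<phi> holomorphic_on S - pts"
  shows "rect_integral \<phi> s t y y' = 2 * of_real pi * \<i> * (\<Sum>p\<in>pts. residue \<phi> p)"
proof -
  let ?g = "rectpath (Complex s y) (Complex t y')"
  have im: "path_image ?g \<subseteq> S - pts"
    using path_image_rectpath_subset_cbox[of "Complex s y" "Complex t y'"]
      path_image_rectpath_inter_box[of "Complex s y" "Complex t y'"] assms by auto
  have "contour_integral ?g \<phi> = 2 * of_real pi * \<i> * (\<Sum>p\<in>pts. winding_number ?g p * residue \<phi> p)"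
  proof -
    have "\<forall>z. z \<notin> S \<longrightarrow> winding_number ?g z = 0"
      using assms by (auto intro!: winding_number_rectpath_outside)
    then show ?thesis using Residue_theorem[OF S pts(1) holo _ _ im] by simp
  qed
  also have "(\<Sum>p\<in>pts. winding_number ?g p * residue \<phi> p) = (\<Sum>p\<in>pts. residue \<phi> p)"
    using pts by (intro sum.cong) (auto simp: winding_number_rectpath)
  finally show ?thesis
    using contour_integral_rectpath[OF assms(1,2)] holomorphic_on_imp_continuous_on[OF holo] im
    by (metis continuous_on_subset)
qed

lemma norm_vline_le:
  assumes "y \<le> y'" "\<And>\<eta>. \<eta> \<in> {y..y'} \<Longrightarrow> norm (\<phi> (Complex s \<eta>)) \<le> B"
    and "continuous_on {y..y'} (\<lambda>\<eta>. \<phi> (Complex s \<eta>))"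
  shows "norm (vline \<phi> s y y') \<le> B * (y' - y)"
  unfolding vline_def using integral_bound[OF assms(1,3,2)] by simp

section \<open>The two factors of the contour integrand\<close>

text \<open>The zero \<open>x exp(\<i>\<pi>/4)\<close> of \<open>x\<^sup>2 + \<i>z\<^sup>2\<close> in the first quadrant; the other one is its
  negative.\<close>

definition integrand_pole :: "real \<Rightarrow> complex" where
  "integrand_pole x = Complex (x / sqrt 2) (x / sqrt 2)"

lemma integrand_pole_square: "(integrand_pole x)\<^sup>2 = \<i> * of_real (x\<^sup>2)"
  by (simp add: integrand_pole_def complex_eq_iff power2_eq_square)

lemma denominator_factor:
  "of_real (x\<^sup>2) + \<i> * z\<^sup>2 = \<i> * ((z - integrand_pole x) * (z + integrand_pole x))"
proof -
  have "(z - integrand_pole x) * (z + integrand_pole x) = z\<^sup>2 - (integrand_pole x)\<^sup>2"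
    by (simp add: power2_eq_square algebra_simps)
  then show ?thesis unfolding integrand_pole_square by (simp add: right_diff_distrib)
qed

lemma norm_denominator:
  "norm (of_real (x\<^sup>2) + \<i> * z\<^sup>2) = norm (z - integrand_pole x) * norm (z + integrand_pole x)"
  unfolding denominator_factor by (simp add: norm_mult)

lemma norm_integrand:
  "norm (integrand x z) =
     exp ((Im z)\<^sup>2 - (Re z)\<^sup>2) / (norm (z - integrand_pole x) * norm (z + integrand_pole x))"
  unfolding integrand_def norm_divide norm_denominator
  by (simp add: Re_power2)

lemma integrand_minus: "integrand x (- z) = integrand x z"
  by (simp add: integrand_def)

lemma integrand_holomorphic:
  assumes "integrand_pole x \<notin> S" "- integrand_pole x \<notin> S"
  shows "integrand x holomorphic_on S"
  unfolding integrand_def denominator_factor using assms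
  by (intro holomorphic_intros) (auto simp: add_eq_0_iff2)

text \<open>It has simple poles exactly at the midpoint nodes \<open>(k - 1/2) \<pi>/\<alpha>\<close>, decays like
  \<open>exp(-2\<alpha> Im z)\<close> in the upper half-plane and tends to \<open>1\<close> in the lower one.\<close>

definition midpoint_kernel :: "real \<Rightarrow> complex \<Rightarrow> complex" where
  "midpoint_kernel \<alpha> z = 1 / (1 + exp (- 2 * \<i> * of_real \<alpha> * z))"

lemma kernel_denominator_zero_imp_node:
  assumes "\<alpha> > 0" "1 + exp (- 2 * \<i> * of_real \<alpha> * z) = 0"
  shows "\<exists>k\<ge>1. z = of_real ((real k - 1/2) * (pi / \<alpha>)) \<or> z = - of_real ((real k - 1/2) * (pi / \<alpha>))"
proof -
  have "exp (\<i> * of_real pi - 2 * \<i> * of_real \<alpha> * z) = 1"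
    using assms(2) by (simp add: exp_diff exp_minus field_simps add_eq_0_iff)
  then obtain n :: int where n: "2 * \<alpha> * Im z = 0" "pi - 2 * \<alpha> * Re z = of_int (2 * n) * pi"
    by (auto simp: exp_eq_1)
  have Im: "Im z = 0" using n assms by simp
  have Re: "Re z = (1/2 - of_int n) * (pi / \<alpha>)"
    using n(2) assms by (simp add: field_simps)
  show ?thesis
  proof (cases "n \<ge> 1")
    case True
    then have "z = - of_real ((real (nat n) - 1/2) * (pi / \<alpha>))"
      using Im Re True assms(1) by (simp add: complex_eq_iff divide_simps) (simp add: algebra_simps)
    with True show ?thesis by (intro exI[of _ "nat n"]) auto
  next
    case False
    then have "z = of_real ((real (nat (1 - n)) - 1/2) * (pi / \<alpha>))"
      using Im Re by (simp add: complex_eq_iff field_simps)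
    with False show ?thesis by (intro exI[of _ "nat (1 - n)"]) auto
  qed
qed

lemma kernel_denominator_nz_upper:
  assumes "\<alpha> > 0" "Im z > 0"
  shows "1 + exp (- 2 * \<i> * of_real \<alpha> * z) \<noteq> 0"
  using kernel_denominator_zero_imp_node[OF assms(1), of z] assms by auto

text \<open>This symmetry lets the lower edge of a symmetric rectangle be folded onto the upper edge.\<close>

lemma midpoint_kernel_minus:
  assumes "1 + exp (- 2 * \<i> * of_real \<alpha> * z) \<noteq> 0"
  shows "midpoint_kernel \<alpha> (- z) = 1 - midpoint_kernel \<alpha> z"
proof -
  let ?e = "exp (- 2 * \<i> * of_real \<alpha> * z)"
  have "exp (- 2 * \<i> * of_real \<alpha> * (- z)) = inverse ?e"
    by (simp flip: exp_minus)
  then show ?thesis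
    unfolding midpoint_kernel_def using assms
    by (simp only:) (simp add: field_simps add.commute)
qed

lemma norm_midpoint_kernel_upper:
  assumes "\<alpha> > 0" "Im z > 0"
  shows "norm (midpoint_kernel \<alpha> z) \<le> 1 / (exp (2 * \<alpha> * Im z) - 1)"
proof -
  have "exp (2 * \<alpha> * Im z) - 1 \<le> norm (1 + exp (- 2 * \<i> * of_real \<alpha> * z))"
    using norm_triangle_ineq4[of "1 + exp (- 2 * \<i> * of_real \<alpha> * z)" 1] by simp
  moreover have "exp (2 * \<alpha> * Im z) - 1 > 0"
    using assms by simp
  ultimately show ?thesis
    unfolding midpoint_kernel_def norm_divide norm_one by (intro divide_left_mono mult_pos_pos) linarith+
qed

text \<open>The vertical lines halfway between consecutive nodes: there \<open>exp(-2\<i>\<alpha>z)\<close> is real and positive,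
  so the denominator stays away from \<open>0\<close> and the sides of the rectangles are harmless.\<close>

lemma norm_midpoint_kernel_side:
  assumes "\<alpha> > 0" "Re z = real m * (pi / \<alpha>) \<or> Re z = - (real m * (pi / \<alpha>))"
  shows "norm (midpoint_kernel \<alpha> z) \<le> 1" "1 + exp (- 2 * \<i> * of_real \<alpha> * z) \<noteq> 0"
proof -
  have "exp (- 2 * \<i> * of_real \<alpha> * z) = of_real (exp (2 * \<alpha> * Im z))"
  proof -
    obtain n :: int where n: "Re z = of_int n * (pi / \<alpha>)"
      using assms(2) by (metis of_int_minus of_int_of_nat_eq mult_minus_left)
    have "- 2 * \<i> * of_real \<alpha> * z = of_real (2 * \<alpha> * Im z) + \<i> * (of_int (- n) * (of_real pi * 2))"
      using n assms(1) by (simp add: complex_eq_iff field_simps)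
    then have "exp (- 2 * \<i> * of_real \<alpha> * z) = of_real (exp (2 * \<alpha> * Im z)) * exp (\<i> * (of_int (- n) * (of_real pi * 2)))"
      by (simp only: exp_add exp_of_real)
    moreover have "exp (\<i> * (of_int (- n) * (of_real pi * 2))) = 1"
      by (rule exp_2pi_1_int)
    ultimately show ?thesis by (simp only: mult_1_right)
  qed
  then have *: "1 + exp (- 2 * \<i> * of_real \<alpha> * z) = of_real (1 + exp (2 * \<alpha> * Im z))" by simp
  have p: "1 + exp (2 * \<alpha> * Im z) > 0" by (simp add: add_pos_pos)
  show "norm (midpoint_kernel \<alpha> z) \<le> 1"
    unfolding midpoint_kernel_def * norm_divide norm_of_real using p by simp
  show "1 + exp (- 2 * \<i> * of_real \<alpha> * z) \<noteq> 0"
    unfolding * using p by (metis of_real_eq_0_iff less_irrefl)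
qed

section \<open>The midpoint rule as a contour integral\<close>

definition sampled_integrand :: "real \<Rightarrow> real \<Rightarrow> complex \<Rightarrow> complex" where
  "sampled_integrand \<alpha> x z = integrand x z * midpoint_kernel \<alpha> z"

lemma sampled_integrand_quotient:
  "sampled_integrand \<alpha> x = (\<lambda>z. integrand x z / (1 + exp (- 2 * \<i> * of_real \<alpha> * z)))"
  by (simp add: fun_eq_iff sampled_integrand_def midpoint_kernel_def)

definition grid :: "real \<Rightarrow> nat \<Rightarrow> real" where
  "grid \<alpha> k = (real k - 1/2) * (pi / \<alpha>)"

lemma residue_sampled_integrand_grid:
  assumes "\<alpha> > 0" "x > 0" "p = of_real t" "t = grid \<alpha> k \<or> t = - grid \<alpha> k"
  shows "residue (sampled_integrand \<alpha> x) p = integrand x p / (- 2 * \<i> * of_real \<alpha> * - 1)"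
proof -
  define a where "a = x / sqrt 2"
  \<comment> \<open>The strip between the two zeros of the denominator of the integrand.\<close>
  define S where "S = {z. Im z < a} \<inter> {z. - a < Im z}"
  have a: "a > 0" using assms by (simp add: a_def)
  have e: "exp (- 2 * \<i> * of_real \<alpha> * p) = -1"
  proof -
    obtain n :: int where n: "t = (of_int n - 1/2) * (pi / \<alpha>)"
    proof (cases "t = grid \<alpha> k")
      case True then show ?thesis using that[of "int k"] by (simp add: grid_def)
    next
      case False
      then show ?thesis using that[of "1 - int k"] assms(4) by (simp add: grid_def algebra_simps)
    qed
    have "- 2 * \<i> * of_real \<alpha> * p = \<i> * of_real pi + \<i> * (of_int (- n) * (of_real pi * 2))"
      using n assms(1,3) by (simp add: complex_eq_iff field_simps)
    moreover have "exp (\<i> * (of_int (- n) * (of_real pi * 2))) = 1"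
      by (rule exp_2pi_1_int)
    ultimately show ?thesis by (simp only: exp_add mult_1_right exp_pi_i')
  qed
  have nz: "integrand x p \<noteq> 0"
    using assms square_plus_i_square_nz[OF assms(2), of t] by (simp add: integrand_def)
  show ?thesis
    unfolding sampled_integrand_quotient
  proof (rule residue_simple_pole_deriv)
    show "integrand x holomorphic_on S"
      by (rule integrand_holomorphic) (auto simp: S_def integrand_pole_def a_def)
    show "(\<lambda>z. 1 + exp (- 2 * \<i> * of_real \<alpha> * z)) holomorphic_on S"
      by (intro holomorphic_intros)
    show "open S" unfolding S_def by (intro open_Int open_halfspace_Im_lt open_halfspace_Im_gt)
    show "connected S" unfolding S_def
      by (intro convex_connected convex_Int convex_halfspace_Im_lt convex_halfspace_Im_gt)
    show "p \<in> S" using a assms by (simp add: S_def)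
    show "((\<lambda>z. 1 + exp (- 2 * \<i> * of_real \<alpha> * z)) has_field_derivative (- 2 * \<i> * of_real \<alpha> * - 1)) (at p)"
      unfolding e[symmetric] by (rule derivative_eq_intros refl | simp)+
    show "1 + exp (- 2 * \<i> * of_real \<alpha> * p) = 0" using e by simp
  qed (use nz assms in auto)
qed

lemma rect_integral_grid:
  assumes "\<alpha> > 0" "x > 0" "0 < H" "H < x / sqrt 2" "m \<ge> 1"
  shows "rect_integral (sampled_integrand \<alpha> x) (- (real m * (pi / \<alpha>))) (real m * (pi / \<alpha>)) (- H) H =
     2 * of_real (pi / \<alpha>) * (\<Sum>k=1..m. integrand x (of_real (grid \<alpha> k)))"
proof -
  define h where "h = pi / \<alpha>"
  have h: "h > 0" using assms by (simp add: h_def)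
  define a where "a = x / sqrt 2"
  define P where "P = (\<lambda>k. complex_of_real (grid \<alpha> k)) ` {1..m}"
  define M where "M = (\<lambda>k. - complex_of_real (grid \<alpha> k)) ` {1..m}"
  have grid: "grid \<alpha> k = (real k - 1/2) * h" for k by (simp add: grid_def h_def)
  have gridp: "grid \<alpha> k > 0" if "k \<ge> 1" for k using that h by (simp add: grid)
  have gridm: "grid \<alpha> k < real m * h" if "k \<le> m" for k
    using that h by (simp add: grid)
  have gridm': "grid \<alpha> k \<ge> (real m + 1/2) * h" if "k > m" for k
    using that h unfolding grid by (intro mult_right_mono) auto
  have inj: "inj_on (\<lambda>k. complex_of_real (grid \<alpha> k)) {1..m}" "inj_on (\<lambda>k. - complex_of_real (grid \<alpha> k)) {1..m}"
    using h by (auto simp: inj_on_def grid)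
  \<comment> \<open>P and M hold the nodes to the right and to the left of 0; the half-widths \<open>m h\<close> and \<open>(m + 1/2) h\<close> separate node m from node m + 1.\<close>
  have disj: "P \<inter> M = {}"
  proof -
    have "complex_of_real (grid \<alpha> k) \<noteq> - complex_of_real (grid \<alpha> l)" if "k \<ge> 1" "l \<ge> 1" for k l
      using gridp[OF that(1)] gridp[OF that(2)] by (auto simp: complex_eq_iff)
    then show ?thesis by (auto simp: P_def M_def)
  qed
  let ?R = "real m * h"
  define S where "S = box (Complex (- ((real m + 1/2) * h)) (- a)) (Complex ((real m + 1/2) * h) a)"
  have "rect_integral (sampled_integrand \<alpha> x) (- ?R) ?R (- H) H =
     2 * of_real pi * \<i> * (\<Sum>p\<in>P \<union> M. residue (sampled_integrand \<alpha> x) p)"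
  proof (rule rect_integral_residues)
    show "open S" "connected S" unfolding S_def by (auto intro!: convex_connected convex_box)
    show "P \<union> M \<subseteq> box (Complex (- ?R) (- H)) (Complex ?R H)"
    proof -
      have "complex_of_real (grid \<alpha> k) \<in> box (Complex (- ?R) (- H)) (Complex ?R H)"
           "- complex_of_real (grid \<alpha> k) \<in> box (Complex (- ?R) (- H)) (Complex ?R H)" if "k \<in> {1..m}" for k
        using gridp[of k] gridm[of k] that assms by (auto simp: in_box_complex_iff)
      then show ?thesis by (auto simp: P_def M_def)
    qed
    show "cbox (Complex (- ?R) (- H)) (Complex ?R H) \<subseteq> S"
    proof -
      have "?R < (real m + 1/2) * h" using h by simp
      then show ?thesis
        using assms by (auto simp: in_box_complex_iff in_cbox_complex_iff S_def a_def)
    qed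
    show "sampled_integrand \<alpha> x holomorphic_on S - (P \<union> M)"
      unfolding sampled_integrand_quotient
    proof (intro holomorphic_intros integrand_holomorphic)
      show "integrand_pole x \<notin> S - (P \<union> M)" "- integrand_pole x \<notin> S - (P \<union> M)"
        by (auto simp: S_def in_box_complex_iff integrand_pole_def a_def)
      show "1 + exp (- 2 * \<i> * of_real \<alpha> * z) \<noteq> 0" if "z \<in> S - (P \<union> M)" for z
      proof
        assume "1 + exp (- 2 * \<i> * of_real \<alpha> * z) = 0"
        from kernel_denominator_zero_imp_node[OF assms(1) this] obtain k where
          k: "k \<ge> 1" "z = of_real (grid \<alpha> k) \<or> z = - of_real (grid \<alpha> k)" by (auto simp: grid_def)
        have "k \<le> m"
        proof (rule ccontr)
          assume "\<not> k \<le> m"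
          then have "grid \<alpha> k \<ge> (real m + 1/2) * h" using gridm' by auto
          then show False using k that by (auto simp: S_def in_box_complex_iff)
        qed
        then show False using k that by (auto simp: P_def M_def)
      qed
    qed
  qed (use h assms in \<open>auto simp: P_def M_def\<close>)
  also have "(\<Sum>p\<in>P \<union> M. residue (sampled_integrand \<alpha> x) p) =
     (\<Sum>p\<in>P \<union> M. integrand x p / (2 * \<i> * of_real \<alpha>))"
  proof (rule sum.cong)
    fix p assume "p \<in> P \<union> M"
    then obtain k t where "p = of_real t" "t = grid \<alpha> k \<or> t = - grid \<alpha> k"
      unfolding P_def M_def by (metis (no_types, lifting) UnE imageE of_real_minus)
    from residue_sampled_integrand_grid[OF assms(1,2) this]
    show "residue (sampled_integrand \<alpha> x) p = integrand x p / (2 * \<i> * of_real \<alpha>)" by simp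
  qed simp
  also have "\<dots> = (\<Sum>p\<in>P. integrand x p / (2 * \<i> * of_real \<alpha>)) + (\<Sum>p\<in>M. integrand x p / (2 * \<i> * of_real \<alpha>))"
    by (rule sum.union_disjoint) (use disj in \<open>auto simp: P_def M_def\<close>)
  also have "(\<Sum>p\<in>P. integrand x p / (2 * \<i> * of_real \<alpha>)) =
     (\<Sum>k=1..m. integrand x (of_real (grid \<alpha> k)) / (2 * \<i> * of_real \<alpha>))"
    unfolding P_def by (subst sum.reindex[OF inj(1)]) simp
  also have "(\<Sum>p\<in>M. integrand x p / (2 * \<i> * of_real \<alpha>)) =
     (\<Sum>k=1..m. integrand x (of_real (grid \<alpha> k)) / (2 * \<i> * of_real \<alpha>))"
    unfolding M_def by (subst sum.reindex[OF inj(2)]) (simp add: integrand_minus)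
  finally have "rect_integral (sampled_integrand \<alpha> x) (- ?R) ?R (- H) H =
      2 * of_real pi * \<i> * (2 * (\<Sum>k=1..m. integrand x (of_real (grid \<alpha> k)) / (2 * \<i> * of_real \<alpha>)))"
    by simp
  also have "\<dots> = 2 * of_real (pi / \<alpha>) * (\<Sum>k=1..m. integrand x (of_real (grid \<alpha> k)))"
    unfolding sum_divide_distrib[symmetric] using assms by (simp add: field_simps)
  finally show ?thesis by (simp add: h_def)
qed

lemma sampled_integrand_minus:
  assumes "1 + exp (- 2 * \<i> * of_real \<alpha> * z) \<noteq> 0"
  shows "sampled_integrand \<alpha> x (- z) = integrand x z - sampled_integrand \<alpha> x z"
  unfolding sampled_integrand_def midpoint_kernel_minus[OF assms] integrand_minus
  by (simp add: right_diff_distrib)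

lemma norm_integrand_side_le:
  assumes "x > 0" "\<bar>Re z\<bar> = R" "R \<ge> x / sqrt 2 + 1" "\<bar>Im z\<bar> \<le> Y"
  shows "norm (integrand x z) \<le> exp (Y\<^sup>2 - R\<^sup>2)"
proof -
  define a where "a = x / sqrt 2"
  have a: "a > 0" using assms by (simp add: a_def)
  have "norm (z - integrand_pole x) \<ge> 1"
    using abs_Re_le_cmod[of "z - integrand_pole x"] assms(2,3) a
    by (simp add: integrand_pole_def flip: a_def)
  moreover have "norm (z + integrand_pole x) \<ge> 1"
    using abs_Re_le_cmod[of "z + integrand_pole x"] assms(2,3) a
    by (simp add: integrand_pole_def flip: a_def)
  ultimately have "norm (z - integrand_pole x) * norm (z + integrand_pole x) \<ge> 1"
    using mult_mono[of 1 _ 1] by fastforce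
  then have "norm (integrand x z) \<le> exp ((Im z)\<^sup>2 - (Re z)\<^sup>2) / 1"
    unfolding norm_integrand by (intro divide_left_mono) auto
  also have "\<dots> \<le> exp (Y\<^sup>2 - R\<^sup>2)"
    using assms power_mono[OF assms(4), of 2] by auto
  finally show ?thesis .
qed

lemma continuous_vertical:
  assumes "continuous_on T \<phi>" "\<And>y. y \<in> S \<Longrightarrow> Complex s y \<in> T"
  shows "continuous_on S (\<lambda>y. \<phi> (Complex s y))"
  by (rule continuous_on_compose2[OF assms(1)]) (use assms in \<open>auto simp: Complex_eq intro!: continuous_intros\<close>)

lemma continuous_horizontal:
  assumes "continuous_on T \<phi>" "\<And>s. s \<in> S \<Longrightarrow> Complex s y \<in> T"
  shows "continuous_on S (\<lambda>s. \<phi> (Complex s y))"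
  by (rule continuous_on_compose2[OF assms(1)]) (use assms in \<open>auto simp: Complex_eq intro!: continuous_intros\<close>)

lemma integrand_sides:
  assumes "x > 0" "\<bar>s\<bar> = R" "R \<ge> x / sqrt 2 + 1" "y \<le> y'" "\<bar>y\<bar> \<le> Y" "\<bar>y'\<bar> \<le> Y"
  shows "norm (vline (integrand x) s y y') \<le> exp (Y\<^sup>2 - R\<^sup>2) * (y' - y)"
proof (rule norm_vline_le)
  show "norm (integrand x (Complex s \<eta>)) \<le> exp (Y\<^sup>2 - R\<^sup>2)" if "\<eta> \<in> {y..y'}" for \<eta>
    using that assms by (intro norm_integrand_side_le) auto
  show "continuous_on {y..y'} (\<lambda>\<eta>. integrand x (Complex s \<eta>))"
  proof (rule continuous_vertical)
    show "continuous_on {z. \<bar>Re z\<bar> = R} (integrand x)"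
      using assms by (intro holomorphic_on_imp_continuous_on integrand_holomorphic) (auto simp: integrand_pole_def)
  qed (use assms in auto)
qed (use assms in auto)

lemma sampled_integrand_sides:
  assumes "\<alpha> > 0" "x > 0" "\<bar>s\<bar> = real m * (pi / \<alpha>)" "real m * (pi / \<alpha>) \<ge> x / sqrt 2 + 1" "y \<le> y'" "\<bar>y\<bar> \<le> Y" "\<bar>y'\<bar> \<le> Y"
  shows "norm (vline (sampled_integrand \<alpha> x) s y y') \<le> exp (Y\<^sup>2 - (real m * (pi / \<alpha>))\<^sup>2) * (y' - y)"
proof (rule norm_vline_le)
  let ?R = "real m * (pi / \<alpha>)"
  have s: "s = ?R \<or> s = - ?R" using assms by linarith
  show "norm (sampled_integrand \<alpha> x (Complex s \<eta>)) \<le> exp (Y\<^sup>2 - ?R\<^sup>2)" if "\<eta> \<in> {y..y'}" for \<eta>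
  proof -
    have "norm (sampled_integrand \<alpha> x (Complex s \<eta>)) \<le> exp (Y\<^sup>2 - ?R\<^sup>2) * 1"
      unfolding sampled_integrand_def norm_mult using that assms s
      by (intro mult_mono norm_integrand_side_le norm_midpoint_kernel_side(1)[of _ _ m]) auto
    then show ?thesis by simp
  qed
  have ns: "x / sqrt 2 \<noteq> s" "x / sqrt 2 \<noteq> - s"
    using s assms(4) divide_pos_pos[OF assms(2), of "sqrt 2"] by auto
  show "continuous_on {y..y'} (\<lambda>\<eta>. sampled_integrand \<alpha> x (Complex s \<eta>))"
  proof (rule continuous_vertical)
    show "continuous_on {z. Re z = s} (sampled_integrand \<alpha> x)"
      unfolding sampled_integrand_quotient using norm_midpoint_kernel_side(2)[OF assms(1), of _ m] s ns
      by (intro holomorphic_on_imp_continuous_on holomorphic_intros integrand_holomorphic)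
         (auto simp: integrand_pole_def)
  qed (use assms in auto)
qed (use assms in auto)

text \<open>The rectangle with corners \<open>\<plusminus>R \<plusminus> \<i>H\<close> collects the nodes up to index \<open>m\<close> in both
  directions.  Folding its lower edge onto the upper one by \<open>z \<mapsto> -z\<close> replaces \<open>f g\<close> there by
  \<open>f - f g\<close>; the \<open>f\<close>-part slides down to the real axis without meeting a pole.  Six side lengths
  \<open>H\<close> are left over, each with an integrand of size \<open>exp(H\<^sup>2 - R\<^sup>2)\<close>.\<close>

lemma quadrature_identity:
  assumes "\<alpha> > 0" "x > 0" "0 < H" "H < x / sqrt 2"
    and R: "R = real m * (pi / \<alpha>)" "R \<ge> x / sqrt 2 + 1"
  shows "norm (integral {-R..R} (\<lambda>t. integrand x (of_real t))
       - 2 * of_real (pi / \<alpha>) * (\<Sum>k=1..m. integrand x (of_real (grid \<alpha> k)))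
       - 2 * hline (sampled_integrand \<alpha> x) H (-R) R) \<le> 6 * H * exp (H\<^sup>2 - R\<^sup>2)"
proof -
  let ?f = "integrand x" and ?\<phi> = "sampled_integrand \<alpha> x"
  define a where "a = x / sqrt 2"
  have a: "a > 0" "H < a" using assms by (auto simp: a_def)
  have Rp: "R > 0" using a R by (simp add: a_def)
  then have m: "m \<ge> 1" using R by (cases m) auto
  have strip: "?f holomorphic_on {z. \<bar>Im z\<bar> < a}"
    by (rule integrand_holomorphic) (use a assms(3) in \<open>auto simp: integrand_pole_def simp flip: a_def\<close>)
  have cont_f: "continuous_on {-R..R} (\<lambda>s. ?f (Complex s H))"
    using a assms(3) by (intro continuous_horizontal[OF holomorphic_on_imp_continuous_on[OF strip]]) auto
  have cont_phi: "continuous_on {-R..R} (\<lambda>s. ?\<phi> (Complex s H))"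
  proof (rule continuous_horizontal)
    show "continuous_on {z. Im z = H} ?\<phi>"
      unfolding sampled_integrand_quotient
      using kernel_denominator_nz_upper[OF assms(1)] a assms(3)
      by (intro holomorphic_on_imp_continuous_on holomorphic_intros integrand_holomorphic)
         (auto simp: integrand_pole_def a_def)
  qed auto
  have "hline ?\<phi> (-H) (-R) R = integral {-R..R} (\<lambda>s. ?\<phi> (Complex (- s) (- H)))"
    unfolding hline_def using Henstock_Kurzweil_Integration.integral_reflect_real[of R "-R" "\<lambda>s. ?\<phi> (Complex s (- H))"] by simp
  also have "\<dots> = integral {-R..R} (\<lambda>s. ?f (Complex s H) - ?\<phi> (Complex s H))"
  proof (rule integral_cong)
    fix s
    have "Complex (- s) (- H) = - Complex s H" by (simp add: complex_eq_iff)
    then show "?\<phi> (Complex (- s) (- H)) = ?f (Complex s H) - ?\<phi> (Complex s H)"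
      using sampled_integrand_minus kernel_denominator_nz_upper[OF assms(1), of "Complex s H"] assms(3)
      by simp
  qed
  also have "\<dots> = hline ?f H (-R) R - hline ?\<phi> H (-R) R"
    unfolding hline_def using cont_f cont_phi by (intro integral_diff integrable_continuous_interval)
  finally have 1: "hline ?\<phi> (-H) (-R) R = hline ?f H (-R) R - hline ?\<phi> H (-R) R" .
  have 2: "rect_integral ?f (-R) R 0 H = 0"
  proof -
    have "rect_integral ?f (-R) R 0 H = 2 * of_real pi * \<i> * (\<Sum>p\<in>{}. residue ?f p)"
    proof (rule rect_integral_residues)
      show "?f holomorphic_on {z. Im z < a} \<inter> {z. - a < Im z} - {}"
        by (rule holomorphic_on_subset[OF strip]) auto
      show "open ({z. Im z < a} \<inter> {z. - a < Im z})" by (intro open_Int open_halfspace_Im_lt open_halfspace_Im_gt)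
      show "connected ({z. Im z < a} \<inter> {z. - a < Im z})"
        by (intro convex_connected convex_Int convex_halfspace_Im_lt convex_halfspace_Im_gt)
    qed (use a Rp assms in \<open>auto simp: in_cbox_complex_iff\<close>)
    then show ?thesis by simp
  qed
  have 3: "hline ?f 0 (-R) R = integral {-R..R} (\<lambda>t. ?f (of_real t))"
    by (simp add: hline_def complex_of_real_def)
  have 4: "rect_integral ?\<phi> (-R) R (-H) H = 2 * of_real (pi / \<alpha>) * (\<Sum>k=1..m. ?f (of_real (grid \<alpha> k)))"
    unfolding R(1) by (rule rect_integral_grid) (use assms m in auto)
  have eq: "integral {-R..R} (\<lambda>t. ?f (of_real t)) - 2 * of_real (pi / \<alpha>) * (\<Sum>k=1..m. ?f (of_real (grid \<alpha> k)))
       - 2 * hline ?\<phi> H (-R) R = - (\<i> * (vline ?\<phi> R (-H) H - vline ?\<phi> (-R) (-H) H + vline ?f R 0 H - vline ?f (-R) 0 H))"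
    using 2 unfolding 4[symmetric] 3[symmetric] rect_integral_def 1 by (simp add: algebra_simps)
  have v1: "norm (vline ?\<phi> R (-H) H) \<le> exp (H\<^sup>2 - R\<^sup>2) * (H - - H)"
           "norm (vline ?\<phi> (-R) (-H) H) \<le> exp (H\<^sup>2 - R\<^sup>2) * (H - - H)"
    unfolding R(1) by (rule sampled_integrand_sides; use assms Rp in simp)+
  have v2: "norm (vline ?f R 0 H) \<le> exp (H\<^sup>2 - R\<^sup>2) * (H - 0)"
           "norm (vline ?f (-R) 0 H) \<le> exp (H\<^sup>2 - R\<^sup>2) * (H - 0)"
    by (rule integrand_sides; use assms Rp in simp)+
  have "norm (- (\<i> * (vline ?\<phi> R (-H) H - vline ?\<phi> (-R) (-H) H + vline ?f R 0 H - vline ?f (-R) 0 H)))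
     = norm (vline ?\<phi> R (-H) H - vline ?\<phi> (-R) (-H) H + vline ?f R 0 H - vline ?f (-R) 0 H)"
    by (simp add: norm_mult)
  also have "\<dots> \<le> norm (vline ?\<phi> R (-H) H) + norm (vline ?\<phi> (-R) (-H) H) + norm (vline ?f R 0 H) + norm (vline ?f (-R) 0 H)"
    by (rule order_trans[OF norm_triangle_ineq4] add_right_mono order_trans[OF norm_triangle_ineq])+ simp
  also have "\<dots> \<le> 6 * H * exp (H\<^sup>2 - R\<^sup>2)"
    using v1 v2 by (simp add: algebra_simps)
  finally show ?thesis unfolding eq .
qed

section \<open>Moving the contour up to the saddle height\<close>

definition pole_term :: "real \<Rightarrow> real \<Rightarrow> complex" where
  "pole_term \<alpha> x = of_real pi * exp (- (\<i> * of_real (x\<^sup>2))) * midpoint_kernel \<alpha> (integrand_pole x) / integrand_pole x"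

lemma sampled_integrand_holomorphic_upper:
  assumes "\<alpha> > 0" "x > 0" "S \<subseteq> {z. Im z > 0}" "integrand_pole x \<notin> S"
  shows "sampled_integrand \<alpha> x holomorphic_on S"
  unfolding sampled_integrand_quotient
proof (intro holomorphic_intros integrand_holomorphic)
  show "- integrand_pole x \<notin> S"
  proof
    assume "- integrand_pole x \<in> S"
    then have "Im (- integrand_pole x) > 0" using assms(3) by blast
    then show False using assms(2) by (simp add: integrand_pole_def divide_less_0_iff)
  qed
qed (use assms kernel_denominator_nz_upper in auto)

lemma rect_integral_pole:
  assumes "\<alpha> > 0" "x > 0" "0 < y" "s < x / sqrt 2" "x / sqrt 2 < t" "y < x / sqrt 2" "x / sqrt 2 < y'"
  shows "rect_integral (sampled_integrand \<alpha> x) s t y y' = pole_term \<alpha> x"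
proof -
  let ?S = "{z. 0 < Im z}" and ?p = "integrand_pole x"
  let ?\<psi> = "\<lambda>w. exp (- w\<^sup>2) / (1 + exp (- 2 * \<i> * of_real \<alpha> * w)) / (\<i> * (w + ?p))"
  have pS: "?p \<in> ?S" using assms by (simp add: integrand_pole_def)
  have nz: "?p \<noteq> 0" using pS by auto
  have holo: "?\<psi> holomorphic_on ?S"
  proof (intro holomorphic_intros)
    show "\<i> * (w + ?p) \<noteq> 0" if "w \<in> ?S" for w
    proof
      assume "\<i> * (w + ?p) = 0"
      then have "Im (w + ?p) = 0" by simp
      then show False using that pS by auto
    qed
  qed (use kernel_denominator_nz_upper[OF assms(1)] in auto)
  have eq: "sampled_integrand \<alpha> x = (\<lambda>w. ?\<psi> w / (w - ?p))"
    by (simp add: fun_eq_iff sampled_integrand_def midpoint_kernel_def integrand_def denominator_factor mult_ac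
        del: of_real_power)
  have "rect_integral (sampled_integrand \<alpha> x) s t y y' =
      2 * of_real pi * \<i> * (\<Sum>p\<in>{?p}. residue (sampled_integrand \<alpha> x) p)"
  proof (rule rect_integral_residues)
    show "open ?S" by (rule open_halfspace_Im_gt)
    show "connected ?S" by (intro convex_connected convex_halfspace_Im_gt)
    show "sampled_integrand \<alpha> x holomorphic_on ?S - {?p}"
      by (rule sampled_integrand_holomorphic_upper) (use assms in auto)
  qed (use assms in \<open>auto simp: in_cbox_complex_iff in_box_complex_iff integrand_pole_def\<close>)
  moreover have "residue (sampled_integrand \<alpha> x) ?p = ?\<psi> ?p"
    unfolding eq by (rule residue_simple[OF open_halfspace_Im_gt pS holo])
  moreover have "2 * of_real pi * \<i> * (E / u / (\<i> * (?p + ?p))) = of_real pi * E * (1 / u) / ?p" for E u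
    using nz by (simp add: mult_2[symmetric])
  ultimately show ?thesis
    by (simp add: pole_term_def midpoint_kernel_def integrand_pole_square)
qed

lemma rect_integral_no_pole:
  assumes "\<alpha> > 0" "x > 0" "s < t" "0 < y" "y < y'"
    and S: "open S" "convex S" "integrand_pole x \<notin> S" "\<And>z. Re z \<in> {s..t} \<Longrightarrow> Im z \<in> {y..y'} \<Longrightarrow> z \<in> S"
  shows "rect_integral (sampled_integrand \<alpha> x) s t y y' = 0"
proof -
  have "rect_integral (sampled_integrand \<alpha> x) s t y y' =
      2 * of_real pi * \<i> * (\<Sum>p\<in>{}. residue (sampled_integrand \<alpha> x) p)"
  proof (rule rect_integral_residues)
    show "open (S \<inter> {z. 0 < Im z})" using S by (intro open_Int open_halfspace_Im_gt)
    show "connected (S \<inter> {z. 0 < Im z})" using S by (intro convex_connected convex_Int convex_halfspace_Im_gt)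
    show "sampled_integrand \<alpha> x holomorphic_on S \<inter> {z. 0 < Im z} - {}"
      by (rule sampled_integrand_holomorphic_upper) (use assms in auto)
  qed (use assms in \<open>auto simp: in_cbox_complex_iff\<close>)
  then show ?thesis by simp
qed

text \<open>Completing the square: \<open>(Im z)\<^sup>2 - 2\<alpha> Im z = (Im z - \<alpha>)\<^sup>2 - \<alpha>\<^sup>2\<close>.  The factor \<open>exp(-\<alpha>\<^sup>2)\<close> comes out,
  and the height \<open>\<alpha>\<close> is the best one.\<close>

lemma norm_sampled_integrand_le:
  assumes "\<alpha> > 0" "\<alpha> \<le> Im z" "0 < d" "0 < d'" "d \<le> norm (z - integrand_pole x)" "d' \<le> norm (z + integrand_pole x)"
  shows "norm (sampled_integrand \<alpha> x z) \<le>
     exp (- \<alpha>\<^sup>2) / ((1 - exp (- 2 * \<alpha>\<^sup>2)) * (d * d')) * exp ((Im z - \<alpha>)\<^sup>2 - (Re z)\<^sup>2)"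
proof -
  let ?y = "Im z"
  let ?q = "1 - exp (- 2 * \<alpha>\<^sup>2)"
  have q: "?q > 0" using assms by simp
  have y: "\<alpha>\<^sup>2 \<le> \<alpha> * ?y" using assms by (simp add: power2_eq_square)
  have k: "norm (midpoint_kernel \<alpha> z) \<le> exp (- (2 * \<alpha> * ?y)) / ?q"
  proof -
    have "norm (midpoint_kernel \<alpha> z) \<le> 1 / (exp (2 * \<alpha> * ?y) - 1)"
      using assms by (intro norm_midpoint_kernel_upper) auto
    also have "exp (2 * \<alpha> * ?y) - 1 = exp (2 * \<alpha> * ?y) * (1 - exp (- (2 * \<alpha> * ?y)))"
      by (simp add: right_diff_distrib flip: exp_add)
    also have "1 / (exp (2 * \<alpha> * ?y) * (1 - exp (- (2 * \<alpha> * ?y)))) = exp (- (2 * \<alpha> * ?y)) / (1 - exp (- (2 * \<alpha> * ?y)))"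
      by (simp add: exp_minus divide_inverse)
    also have "\<dots> \<le> exp (- (2 * \<alpha> * ?y)) / ?q"
    proof (rule divide_left_mono)
      show "?q \<le> 1 - exp (- (2 * \<alpha> * ?y))" using y by simp
      moreover have "?q > 0" by fact
      ultimately show "0 < (1 - exp (- (2 * \<alpha> * ?y))) * ?q" by (intro mult_pos_pos) linarith+
    qed simp
    finally show ?thesis .
  qed
  have i: "norm (integrand x z) \<le> exp (?y\<^sup>2 - (Re z)\<^sup>2) / (d * d')"
    unfolding norm_integrand using assms
    by (intro divide_left_mono mult_mono mult_pos_pos) auto
  have "norm (sampled_integrand \<alpha> x z) \<le> exp (?y\<^sup>2 - (Re z)\<^sup>2) / (d * d') * (exp (- (2 * \<alpha> * ?y)) / ?q)"
    unfolding sampled_integrand_def norm_mult using i k assms by (intro mult_mono) auto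
  also have "\<dots> = exp (?y\<^sup>2 - (Re z)\<^sup>2) * exp (- (2 * \<alpha> * ?y)) / (?q * (d * d'))" by simp
  also have "exp (?y\<^sup>2 - (Re z)\<^sup>2) * exp (- (2 * \<alpha> * ?y)) = exp (- \<alpha>\<^sup>2) * exp ((?y - \<alpha>)\<^sup>2 - (Re z)\<^sup>2)"
    by (simp add: power2_eq_square algebra_simps flip: exp_add)
  finally show ?thesis by simp
qed

lemma norm_hline_gaussian_le:
  assumes "\<And>\<sigma>. \<sigma> \<in> {s..t} \<Longrightarrow> norm (\<phi> (Complex \<sigma> y)) \<le> M * exp (- \<sigma>\<^sup>2)"
    "continuous_on {s..t} (\<lambda>\<sigma>. \<phi> (Complex \<sigma> y))"
  shows "norm (hline \<phi> y s t) \<le> M * integral {s..t} (\<lambda>\<sigma>. exp (- \<sigma>\<^sup>2))"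
proof -
  have "norm (hline \<phi> y s t) \<le> integral {s..t} (\<lambda>\<sigma>. M * exp (- \<sigma>\<^sup>2))"
    unfolding hline_def using assms
    by (intro integral_norm_bound_integral integrable_continuous_interval continuous_intros) auto
  then show ?thesis by simp
qed

lemma norm_hline_le:
  assumes "s \<le> t" "\<And>\<sigma>. \<sigma> \<in> {s..t} \<Longrightarrow> norm (\<phi> (Complex \<sigma> y)) \<le> B"
    "continuous_on {s..t} (\<lambda>\<sigma>. \<phi> (Complex \<sigma> y))"
  shows "norm (hline \<phi> y s t) \<le> B * (t - s)"
  unfolding hline_def using integral_bound[OF assms(1,3,2)] by simp

text \<open>The interval consists of the \<open>2m\<close> cells of length \<open>\<pi>/\<alpha>\<close> around the nodes of index at most \<open>m\<close>
  and their negatives; by evenness the positive nodes are counted twice.\<close>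

definition quadrature_defect :: "real \<Rightarrow> real \<Rightarrow> nat \<Rightarrow> complex" where
  "quadrature_defect \<alpha> x m =
     integral {-(real m * (pi / \<alpha>))..real m * (pi / \<alpha>)} (\<lambda>t. integrand x (of_real t))
       - 2 * of_real (pi / \<alpha>) * (\<Sum>k=1..m. integrand x (of_real (grid \<alpha> k)))"

lemma continuous_corrected_horizontal:
  assumes "\<alpha> > 0" "x > 0" "y > 0" "y \<noteq> x / sqrt 2"
  shows "continuous_on S (\<lambda>\<sigma>. sampled_integrand \<alpha> x (Complex \<sigma> y))"
proof (rule continuous_horizontal)
  show "continuous_on {z. Im z = y} (sampled_integrand \<alpha> x)"
    by (intro holomorphic_on_imp_continuous_on sampled_integrand_holomorphic_upper)
       (use assms in \<open>auto simp: integrand_pole_def\<close>)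
qed auto

lemma continuous_corrected_vertical:
  assumes "\<alpha> > 0" "x > 0" "s \<noteq> x / sqrt 2" "S \<subseteq> {0<..}"
  shows "continuous_on S (\<lambda>\<eta>. sampled_integrand \<alpha> x (Complex s \<eta>))"
proof (rule continuous_vertical)
  show "continuous_on {z. Re z = s \<and> Im z > 0} (sampled_integrand \<alpha> x)"
    by (intro holomorphic_on_imp_continuous_on sampled_integrand_holomorphic_upper)
       (use assms in \<open>auto simp: integrand_pole_def\<close>)
qed (use assms in auto)

text \<open>In the hypothesis on the contour shift, \<open>W\<close> is the part of the new contour that is estimated, \<open>P\<close> is
  the residue contribution picked up on the way, and the vertical sides at \<open>\<plusminus>R\<close> vanish as
  \<open>R \<rightarrow> \<infinity>\<close>.\<close>

lemma quadrature_defect_le: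
  assumes "\<alpha> > 0" "x > 0" "0 < H" "H < x / sqrt 2" "H < \<alpha>"
    and R: "R = real m * (pi / \<alpha>)" "R \<ge> x / sqrt 2 + 1"
    and shift: "hline (sampled_integrand \<alpha> x) H (-R) R =
       W + P + \<i> * (vline (sampled_integrand \<alpha> x) (-R) H \<alpha> - vline (sampled_integrand \<alpha> x) R H \<alpha>)"
    and W: "norm W \<le> B"
  shows "norm (quadrature_defect \<alpha> x m - 2 * P) \<le> 2 * B + 6 * \<alpha> * exp (\<alpha>\<^sup>2 - R\<^sup>2)"
proof -
  let ?\<phi> = "sampled_integrand \<alpha> x"
  define E where "E = quadrature_defect \<alpha> x m - 2 * hline ?\<phi> H (-R) R"
  have a: "x / sqrt 2 > 0" using assms by simp
  have e: "exp (H\<^sup>2 - R\<^sup>2) \<le> exp (\<alpha>\<^sup>2 - R\<^sup>2)" using assms by (simp add: power_mono)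
  have E: "norm E \<le> 6 * H * exp (\<alpha>\<^sup>2 - R\<^sup>2)"
  proof -
    have "norm E \<le> 6 * H * exp (H\<^sup>2 - R\<^sup>2)"
      unfolding E_def quadrature_defect_def R(1)[symmetric] by (rule quadrature_identity) fact+
    also have "\<dots> \<le> 6 * H * exp (\<alpha>\<^sup>2 - R\<^sup>2)" using assms(3) e by (intro mult_left_mono) auto
    finally show ?thesis .
  qed
  have v: "norm (vline ?\<phi> R H \<alpha>) \<le> exp (\<alpha>\<^sup>2 - R\<^sup>2) * (\<alpha> - H)"
          "norm (vline ?\<phi> (-R) H \<alpha>) \<le> exp (\<alpha>\<^sup>2 - R\<^sup>2) * (\<alpha> - H)"
    unfolding R(1) by (rule sampled_integrand_sides; use assms a in simp)+
  have "norm (quadrature_defect \<alpha> x m - 2 * P) = norm (E + 2 * W + 2 * \<i> * (vline ?\<phi> (-R) H \<alpha> - vline ?\<phi> R H \<alpha>))"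
    unfolding E_def shift by (simp add: algebra_simps)
  also have "\<dots> \<le> norm E + norm (2 * W) + norm (2 * \<i> * (vline ?\<phi> (-R) H \<alpha> - vline ?\<phi> R H \<alpha>))"
    by (rule order_trans[OF norm_triangle_ineq] add_right_mono norm_triangle_ineq)+
  also have "norm (2 * W) \<le> 2 * B" using W by (simp add: norm_mult)
  also have "norm (2 * \<i> * (vline ?\<phi> (-R) H \<alpha> - vline ?\<phi> R H \<alpha>)) \<le> 2 * (norm (vline ?\<phi> (-R) H \<alpha>) + norm (vline ?\<phi> R H \<alpha>))"
    using norm_triangle_ineq4[of "vline ?\<phi> (-R) H \<alpha>" "vline ?\<phi> R H \<alpha>"] by (simp add: norm_mult)
  finally have "norm (quadrature_defect \<alpha> x m - 2 * P) \<le> 2 * B + (6 * H + 4 * (\<alpha> - H)) * exp (\<alpha>\<^sup>2 - R\<^sup>2)"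
    using E v by (simp add: algebra_simps)
  also have "\<dots> \<le> 2 * B + 6 * \<alpha> * exp (\<alpha>\<^sup>2 - R\<^sup>2)"
    using assms by (intro add_left_mono mult_right_mono) auto
  finally show ?thesis .
qed

text \<open>On the line \<open>Im z = \<alpha>\<close> the two poles are at vertical distance \<open>|\<alpha> - x/\<surd>2|\<close> and
  \<open>\<alpha> + x/\<surd>2\<close>, whose product is \<open>|\<alpha>\<^sup>2 - x\<^sup>2/2|\<close>.\<close>

lemma norm_hline_saddle_le:
  assumes "\<alpha> > 0" "x > 0" "\<alpha> \<noteq> x / sqrt 2"
  shows "norm (hline (sampled_integrand \<alpha> x) \<alpha> s t) \<le>
     exp (- \<alpha>\<^sup>2) / ((1 - exp (- 2 * \<alpha>\<^sup>2)) * \<bar>\<alpha>\<^sup>2 - x\<^sup>2 / 2\<bar>) * sqrt pi"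
proof -
  define a where "a = x / sqrt 2"
  have a: "a > 0" "\<alpha> \<noteq> a" using assms by (auto simp: a_def)
  have d: "\<bar>\<alpha>\<^sup>2 - x\<^sup>2 / 2\<bar> = \<bar>\<alpha> - a\<bar> * (\<alpha> + a)"
  proof -
    have "\<alpha>\<^sup>2 - x\<^sup>2 / 2 = (\<alpha> - a) * (\<alpha> + a)"
      by (simp add: a_def power2_eq_square algebra_simps)
    then show ?thesis using assms a by (simp add: abs_mult)
  qed
  let ?M = "exp (- \<alpha>\<^sup>2) / ((1 - exp (- 2 * \<alpha>\<^sup>2)) * \<bar>\<alpha>\<^sup>2 - x\<^sup>2 / 2\<bar>)"
  have "norm (hline (sampled_integrand \<alpha> x) \<alpha> s t) \<le> ?M * integral {s..t} (\<lambda>\<sigma>. exp (- \<sigma>\<^sup>2))"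
  proof (rule norm_hline_gaussian_le)
    fix \<sigma>
    have 1: "\<bar>\<alpha> - a\<bar> \<le> norm (Complex \<sigma> \<alpha> - integrand_pole x)"
      using abs_Im_le_cmod[of "Complex \<sigma> \<alpha> - integrand_pole x"] by (simp add: integrand_pole_def a_def)
    have 2: "\<alpha> + a \<le> norm (Complex \<sigma> \<alpha> + integrand_pole x)"
      using abs_Im_le_cmod[of "Complex \<sigma> \<alpha> + integrand_pole x"] by (simp add: integrand_pole_def a_def)
    show "norm (sampled_integrand \<alpha> x (Complex \<sigma> \<alpha>)) \<le> ?M * exp (- \<sigma>\<^sup>2)"
      using norm_sampled_integrand_le[OF assms(1) _ _ _ 1 2] a assms unfolding d by simp
  qed (rule continuous_corrected_horizontal[OF assms(1,2,1,3)])
  also have "\<dots> \<le> ?M * sqrt pi"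
    using assms by (intro mult_left_mono gaussian_interval_le) auto
  finally show ?thesis .
qed

lemma quadrature_defect_pole_below:
  assumes "\<alpha> > 0" "x > 0" "x / sqrt 2 < \<alpha>" "R = real m * (pi / \<alpha>)" "R \<ge> x / sqrt 2 + 1"
  shows "norm (quadrature_defect \<alpha> x m - 2 * pole_term \<alpha> x) \<le>
     2 * (exp (- \<alpha>\<^sup>2) / ((1 - exp (- 2 * \<alpha>\<^sup>2)) * \<bar>\<alpha>\<^sup>2 - x\<^sup>2 / 2\<bar>) * sqrt pi) + 6 * \<alpha> * exp (\<alpha>\<^sup>2 - R\<^sup>2)"
proof -
  have a: "0 < x / sqrt 2" using assms by simp
  then obtain H where H: "0 < H" "H < x / sqrt 2" using dense by blast
  have R: "- R < x / sqrt 2" "x / sqrt 2 < R" using a assms(5) by linarith+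
  have "rect_integral (sampled_integrand \<alpha> x) (-R) R H \<alpha> = pole_term \<alpha> x"
    by (rule rect_integral_pole) fact+
  then have shift: "hline (sampled_integrand \<alpha> x) H (-R) R = hline (sampled_integrand \<alpha> x) \<alpha> (-R) R + pole_term \<alpha> x
      + \<i> * (vline (sampled_integrand \<alpha> x) (-R) H \<alpha> - vline (sampled_integrand \<alpha> x) R H \<alpha>)"
    by (simp add: rect_integral_def algebra_simps)
  show ?thesis
    by (rule quadrature_defect_le[OF _ _ _ _ _ _ _ shift norm_hline_saddle_le]) (use H assms in auto)
qed

lemma quadrature_defect_pole_above:
  assumes "\<alpha> > 0" "x > 0" "\<alpha> < x / sqrt 2" "R = real m * (pi / \<alpha>)" "R \<ge> x / sqrt 2 + 1"
  shows "norm (quadrature_defect \<alpha> x m) \<le>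
     2 * (exp (- \<alpha>\<^sup>2) / ((1 - exp (- 2 * \<alpha>\<^sup>2)) * \<bar>\<alpha>\<^sup>2 - x\<^sup>2 / 2\<bar>) * sqrt pi) + 6 * \<alpha> * exp (\<alpha>\<^sup>2 - R\<^sup>2)"
proof -
  obtain H where H: "0 < H" "H < \<alpha>" using dense[OF assms(1)] by blast
  have R: "R > 0" using assms by linarith
  have "rect_integral (sampled_integrand \<alpha> x) (-R) R H \<alpha> = 0"
  proof (rule rect_integral_no_pole)
    show "open {z. Im z < x / sqrt 2}" by (rule open_halfspace_Im_lt)
    show "convex {z. Im z < x / sqrt 2}" by (rule convex_halfspace_Im_lt)
  qed (use H assms R in \<open>auto simp: integrand_pole_def\<close>)
  then have shift: "hline (sampled_integrand \<alpha> x) H (-R) R = hline (sampled_integrand \<alpha> x) \<alpha> (-R) R + 0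
      + \<i> * (vline (sampled_integrand \<alpha> x) (-R) H \<alpha> - vline (sampled_integrand \<alpha> x) R H \<alpha>)"
    by (simp add: rect_integral_def algebra_simps)
  have "norm (quadrature_defect \<alpha> x m - 2 * 0) \<le>
     2 * (exp (- \<alpha>\<^sup>2) / ((1 - exp (- 2 * \<alpha>\<^sup>2)) * \<bar>\<alpha>\<^sup>2 - x\<^sup>2 / 2\<bar>) * sqrt pi) + 6 * \<alpha> * exp (\<alpha>\<^sup>2 - R\<^sup>2)"
    by (rule quadrature_defect_le[OF _ _ _ _ _ _ _ shift norm_hline_saddle_le]) (use H assms in auto)
  then show ?thesis by simp
qed

lemma hline_combine:
  assumes "s \<le> t" "t \<le> u" "continuous_on {s..u} (\<lambda>\<sigma>. \<phi> (Complex \<sigma> y))"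
  shows "hline \<phi> y s t + hline \<phi> y t u = hline \<phi> y s u"
  unfolding hline_def using assms by (intro Henstock_Kurzweil_Integration.integral_combine integrable_continuous_interval) auto

lemma vline_combine:
  assumes "y \<le> y'" "y' \<le> y''" "continuous_on {y..y''} (\<lambda>\<eta>. \<phi> (Complex s \<eta>))"
  shows "vline \<phi> s y y' + vline \<phi> s y' y'' = vline \<phi> s y y''"
  unfolding vline_def using assms by (intro Henstock_Kurzweil_Integration.integral_combine integrable_continuous_interval) auto

text \<open>The line \<open>Im z = \<alpha>\<close> would pass too close to the pole, so it is replaced on \<open>|Re z - a| \<le> \<alpha>/4\<close>, with
  \<open>a = x/\<surd>2\<close>, by the upper part of a rectangle that stays at distance \<open>\<alpha>/4\<close> from the pole.  The
  detour has length at most \<open>3\<alpha>/2\<close>, and on it \<open>Re z \<ge> a - \<alpha>/4\<close> while \<open>0 \<le> Im z - \<alpha> \<le> a - 3\<alpha>/4\<close>, so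
  that \<open>(Im z - \<alpha>)\<^sup>2 - (Re z)\<^sup>2 \<le> -\<alpha>\<^sup>2/4\<close>.\<close>

lemma quadrature_defect_pole_near:
  assumes "\<alpha> > 0" "x > 0" and near: "3/4 * \<alpha> < x / sqrt 2" "x / sqrt 2 < 5/4 * \<alpha>"
    and R: "R = real m * (pi / \<alpha>)" "R \<ge> x / sqrt 2 + 1" "R > x / sqrt 2 + \<alpha> / 4"
  shows "norm (quadrature_defect \<alpha> x m - 2 * pole_term \<alpha> x) \<le>
     2 * (exp (- \<alpha>\<^sup>2) / ((1 - exp (- 2 * \<alpha>\<^sup>2)) * (\<alpha> / 4 * (\<alpha> + x / sqrt 2))) *
       (sqrt pi + 3 * \<alpha> / 2 * exp (- \<alpha>\<^sup>2 / 4))) + 6 * \<alpha> * exp (\<alpha>\<^sup>2 - R\<^sup>2)"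
proof -
  let ?\<phi> = "sampled_integrand \<alpha> x"
  define a where "a = x / sqrt 2"
  define M where "M = exp (- \<alpha>\<^sup>2) / ((1 - exp (- 2 * \<alpha>\<^sup>2)) * (\<alpha> / 4 * (\<alpha> + a)))"
  define s1 s2 y2 where "s1 = a - \<alpha> / 4" and "s2 = a + \<alpha> / 4" and "y2 = a + \<alpha> / 4"
  note ds = s1_def s2_def y2_def
  have a: "a > 0" "3/4 * \<alpha> < a" "a < 5/4 * \<alpha>" "R > s2" "R \<ge> a + 1" using assms by (simp_all add: a_def s2_def)
  have s: "- R < s1" "s1 < a" "a < s2" "s2 < R" "a < y2" "\<alpha> < y2" "0 < s1"
    using a assms(1) by (simp_all add: ds)
  have "0 < min a \<alpha>" using a assms by simp
  then obtain H where H: "0 < H" "H < a" "H < \<alpha>" using dense[of 0 "min a \<alpha>"] by auto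
  have M: "M \<ge> 0" using assms(1) a by (simp add: M_def)

  have ch: "continuous_on S (\<lambda>\<sigma>. ?\<phi> (Complex \<sigma> y))" if "y > 0" "y \<noteq> a" for S y
    using that assms(1,2) by (intro continuous_corrected_horizontal) (auto simp: a_def)
  have cv: "continuous_on {u..v} (\<lambda>\<eta>. ?\<phi> (Complex s \<eta>))" if "s \<noteq> a" "u > 0" for s u v
    using that assms(1,2) by (intro continuous_corrected_vertical) (auto simp: a_def)

  \<comment> \<open>Three columns of different height; the pole lies in the middle one only.\<close>
  have left: "rect_integral ?\<phi> (-R) s1 H \<alpha> = 0"
  proof (rule rect_integral_no_pole)
    show "open {z. Re z < a}" by (rule open_halfspace_Re_lt)
    show "convex {z. Re z < a}" by (rule convex_halfspace_Re_lt)
  qed (use H s assms in \<open>auto simp: integrand_pole_def a_def\<close>)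
  have right: "rect_integral ?\<phi> s2 R H \<alpha> = 0"
  proof (rule rect_integral_no_pole)
    show "open {z. a < Re z}" by (rule open_halfspace_Re_gt)
    show "convex {z. a < Re z}" by (rule convex_halfspace_Re_gt)
  qed (use H s assms in \<open>auto simp: integrand_pole_def a_def\<close>)
  have middle: "rect_integral ?\<phi> s1 s2 H y2 = pole_term \<alpha> x"
    using assms H s by (intro rect_integral_pole) (auto simp: a_def)
  have bottom: "hline ?\<phi> H (-R) R = hline ?\<phi> H (-R) s1 + hline ?\<phi> H s1 s2 + hline ?\<phi> H s2 R"
    using hline_combine[of "-R" s1 s2 ?\<phi> H] hline_combine[of "-R" s2 R ?\<phi> H] ch[of H] H s by simp
  have v1: "vline ?\<phi> s1 H y2 = vline ?\<phi> s1 H \<alpha> + vline ?\<phi> s1 \<alpha> y2"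
    using vline_combine[of H \<alpha> y2 ?\<phi> s1] cv[of s1] H s by simp
  have v2: "vline ?\<phi> s2 H y2 = vline ?\<phi> s2 H \<alpha> + vline ?\<phi> s2 \<alpha> y2"
    using vline_combine[of H \<alpha> y2 ?\<phi> s2] cv[of s2] H s by simp

  define W where "W = hline ?\<phi> \<alpha> (-R) s1 + \<i> * vline ?\<phi> s1 \<alpha> y2 + hline ?\<phi> y2 s1 s2
     - \<i> * vline ?\<phi> s2 \<alpha> y2 + hline ?\<phi> \<alpha> s2 R"
  have shift: "hline ?\<phi> H (-R) R = W + pole_term \<alpha> x + \<i> * (vline ?\<phi> (-R) H \<alpha> - vline ?\<phi> R H \<alpha>)"
    using left right unfolding middle[symmetric] bottom W_def rect_integral_def v1 v2
    by (simp add: algebra_simps)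

  have sum: "\<alpha> + a \<le> norm (z + integrand_pole x)" if "\<alpha> \<le> Im z" for z
    using abs_Im_le_cmod[of "z + integrand_pole x"] that a assms(1) by (simp add: integrand_pole_def flip: a_def)
  have general: "norm (?\<phi> z) \<le> M * exp ((Im z - \<alpha>)\<^sup>2 - (Re z)\<^sup>2)"
    if "\<alpha> \<le> Im z" "\<alpha> / 4 \<le> \<bar>Re z - a\<bar> \<or> \<alpha> / 4 \<le> \<bar>Im z - a\<bar>" for z
  proof -
    have "\<alpha> / 4 \<le> norm (z - integrand_pole x)"
      using abs_Im_le_cmod[of "z - integrand_pole x"] abs_Re_le_cmod[of "z - integrand_pole x"] that
      by (auto simp: integrand_pole_def simp flip: a_def)
    then show ?thesis
      unfolding M_def using that(1) sum[OF that(1)] a assms(1) by (intro norm_sampled_integrand_le) auto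
  qed
  have bump: "norm (?\<phi> z) \<le> M * exp (- \<alpha>\<^sup>2 / 4)"
    if "\<alpha> \<le> Im z" "Im z \<le> y2" "s1 \<le> Re z" "\<alpha> / 4 \<le> \<bar>Re z - a\<bar> \<or> \<alpha> / 4 \<le> \<bar>Im z - a\<bar>" for z
  proof -
    have "(Im z - \<alpha>)\<^sup>2 \<le> (a - 3/4 * \<alpha>)\<^sup>2" using that by (intro power_mono) (auto simp: y2_def)
    moreover have "(a - \<alpha> / 4)\<^sup>2 \<le> (Re z)\<^sup>2" using that s by (intro power_mono) (auto simp: s1_def)
    moreover have "(a - 3/4 * \<alpha>)\<^sup>2 - (a - \<alpha> / 4)\<^sup>2 = - \<alpha>\<^sup>2 / 4 - \<alpha> * (a - 3/4 * \<alpha>)"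
      by (simp add: power2_eq_square algebra_simps)
    moreover have "\<alpha> * (a - 3/4 * \<alpha>) \<ge> 0" using assms(1) a by simp
    ultimately have "(Im z - \<alpha>)\<^sup>2 - (Re z)\<^sup>2 \<le> - \<alpha>\<^sup>2 / 4" by linarith
    then have "M * exp ((Im z - \<alpha>)\<^sup>2 - (Re z)\<^sup>2) \<le> M * exp (- \<alpha>\<^sup>2 / 4)"
      using M by (intro mult_left_mono) auto
    with general[OF that(1,4)] show ?thesis by linarith
  qed
  let ?G = "\<lambda>u v. integral {u..v} (\<lambda>\<sigma>::real. exp (- \<sigma>\<^sup>2))"
  have cont: "continuous_on {u..v} (\<lambda>\<sigma>. ?\<phi> (Complex \<sigma> \<alpha>))" if "a \<notin> {u..v}" for u v
  proof (rule continuous_horizontal)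
    show "continuous_on {z. Im z = \<alpha> \<and> Re z \<noteq> a} ?\<phi>"
      using assms(1,2) by (intro holomorphic_on_imp_continuous_on sampled_integrand_holomorphic_upper)
         (auto simp: integrand_pole_def a_def)
  qed (use that in auto)
  have W1: "norm (hline ?\<phi> \<alpha> (-R) s1) \<le> M * ?G (-R) s1"
    using general[of "Complex \<sigma> \<alpha>" for \<sigma>] assms(1)
    by (intro norm_hline_gaussian_le cont) (auto simp: s1_def abs_if)
  have W5: "norm (hline ?\<phi> \<alpha> s2 R) \<le> M * ?G s2 R"
    using general[of "Complex \<sigma> \<alpha>" for \<sigma>] assms(1)
    by (intro norm_hline_gaussian_le cont) (auto simp: s2_def abs_if)
  have W2: "norm (vline ?\<phi> s1 \<alpha> y2) \<le> M * exp (- \<alpha>\<^sup>2 / 4) * (y2 - \<alpha>)"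
    using s assms(1) by (intro norm_vline_le bump cv) (auto simp: s1_def)
  have W4: "norm (vline ?\<phi> s2 \<alpha> y2) \<le> M * exp (- \<alpha>\<^sup>2 / 4) * (y2 - \<alpha>)"
    using s assms(1) by (intro norm_vline_le bump cv) (auto simp: s1_def s2_def)
  have W3: "norm (hline ?\<phi> y2 s1 s2) \<le> M * exp (- \<alpha>\<^sup>2 / 4) * (s2 - s1)"
    using s assms(1) a by (intro norm_hline_le bump ch) (auto simp: ds)
  \<comment> \<open>The two straight pieces together see at most one full Gaussian.\<close>
  have G: "?G (-R) s1 + ?G s2 R \<le> sqrt pi"
  proof -
    have "?G (-R) s1 + ?G s1 s2 = ?G (-R) s2" "?G (-R) s2 + ?G s2 R = ?G (-R) R"
      using s by (auto intro!: Henstock_Kurzweil_Integration.integral_combine gaussian_integrable)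
    moreover have "?G s1 s2 \<ge> 0" by (intro Henstock_Kurzweil_Integration.integral_nonneg gaussian_integrable) auto
    ultimately show ?thesis using gaussian_interval_le[of "-R" R] by linarith
  qed
  have "norm W \<le> norm (hline ?\<phi> \<alpha> (-R) s1) + norm (\<i> * vline ?\<phi> s1 \<alpha> y2) + norm (hline ?\<phi> y2 s1 s2)
     + norm (\<i> * vline ?\<phi> s2 \<alpha> y2) + norm (hline ?\<phi> \<alpha> s2 R)"
    unfolding W_def
    by (rule order_trans[OF norm_triangle_ineq] order_trans[OF norm_triangle_ineq4] add_right_mono order_refl)+
  also have "\<dots> \<le> M * (?G (-R) s1 + ?G s2 R) + M * exp (- \<alpha>\<^sup>2 / 4) * (2 * (y2 - \<alpha>) + (s2 - s1))"
    using W1 W2 W3 W4 W5 by (simp add: norm_mult algebra_simps)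
  also have "\<dots> \<le> M * sqrt pi + M * exp (- \<alpha>\<^sup>2 / 4) * (2 * (y2 - \<alpha>) + (s2 - s1))"
    using M G by (intro add_right_mono mult_left_mono)
  also have "\<dots> \<le> M * sqrt pi + M * exp (- \<alpha>\<^sup>2 / 4) * (3 * \<alpha> / 2)"
    using M a by (intro add_left_mono mult_left_mono) (auto simp: ds)
  finally have "norm W \<le> M * (sqrt pi + 3 * \<alpha> / 2 * exp (- \<alpha>\<^sup>2 / 4))" by (simp add: algebra_simps)
  from quadrature_defect_le[OF assms(1,2) H(1) _ H(3) R(1,2) shift this]
  show ?thesis using H(2) by (simp add: M_def a_def)
qed

section \<open>From the midpoint rule to the approximation\<close>

definition fresnel_prefactor :: "real \<Rightarrow> complex" where
  "fresnel_prefactor x = of_real (x / (2 * pi)) * exp (\<i> * of_real (x\<^sup>2 + pi / 4))"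

lemma norm_fresnel_prefactor: "norm (fresnel_prefactor x) = \<bar>x\<bar> / (2 * pi)"
  unfolding fresnel_prefactor_def norm_mult norm_of_real norm_exp_i_times by simp

lemma integrand_pole_polar: "integrand_pole x = of_real x * exp (\<i> * of_real pi / 4)"
proof -
  have "exp (\<i> * of_real pi / 4) = cis (pi / 4)" by (simp add: cis_conv_exp)
  also have "of_real x * cis (pi / 4) = integrand_pole x"
    by (simp add: complex_eq_iff integrand_pole_def cos_45 sin_45 real_div_sqrt field_simps)
  finally show ?thesis by simp
qed

definition pole_correction :: "real \<Rightarrow> real \<Rightarrow> complex" where
  "pole_correction \<alpha> x = 1 / (exp (2 * of_real \<alpha> * of_real x * exp (- \<i> * of_real pi / 4)) + 1)"

lemma midpoint_kernel_integrand_pole: "midpoint_kernel \<alpha> (integrand_pole x) = pole_correction \<alpha> x"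
  unfolding midpoint_kernel_def integrand_pole_polar pole_correction_def exp_minus_quarter
  by (simp add: add.commute mult_ac)

text \<open>The residue at \<open>x exp(\<i>\<pi>/4)\<close> is the exponential correction in the definition of the
  approximation.\<close>

lemma prefactor_pole_term:
  assumes "x > 0"
  shows "fresnel_prefactor x * (2 * pole_term \<alpha> x) = pole_correction \<alpha> x"
proof -
  have "fresnel_prefactor x * (2 * pole_term \<alpha> x) =
     pole_correction \<alpha> x * (exp (\<i> * of_real (x\<^sup>2 + pi / 4)) * exp (- (\<i> * of_real (x\<^sup>2)))) / exp (\<i> * of_real pi / 4)"
    unfolding fresnel_prefactor_def pole_term_def midpoint_kernel_integrand_pole
    unfolding integrand_pole_polar using assms by (simp add: field_simps)
  also have "exp (\<i> * of_real (x\<^sup>2 + pi / 4)) * exp (- (\<i> * of_real (x\<^sup>2))) = exp (\<i> * of_real pi / 4)"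
    by (simp add: algebra_simps flip: exp_add)
  finally show ?thesis by simp
qed

lemma norm_pole_correction_le:
  assumes "\<alpha> > 0" "x > 0"
  shows "norm (pole_correction \<alpha> x) \<le> exp (- sqrt 2 * \<alpha> * x) / (1 - exp (- sqrt 2 * \<alpha> * x))"
proof -
  have i: "2 * \<alpha> * Im (integrand_pole x) = sqrt 2 * \<alpha> * x"
    by (simp add: integrand_pole_def field_simps)
  have "norm (pole_correction \<alpha> x) \<le> 1 / (exp (sqrt 2 * \<alpha> * x) - 1)"
    using norm_midpoint_kernel_upper[of \<alpha> "integrand_pole x"] assms
    unfolding midpoint_kernel_integrand_pole i by (simp add: integrand_pole_def)
  also have "exp (sqrt 2 * \<alpha> * x) - 1 = exp (sqrt 2 * \<alpha> * x) * (1 - exp (- sqrt 2 * \<alpha> * x))"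
    by (simp add: right_diff_distrib flip: exp_add)
  also have "1 / \<dots> = exp (- sqrt 2 * \<alpha> * x) / (1 - exp (- sqrt 2 * \<alpha> * x))"
    by (simp add: exp_minus divide_inverse)
  finally show ?thesis .
qed

lemma A_pos: "A N > 0"
  by (simp add: A_def)

lemma A_square: "(A N)\<^sup>2 = (real N + 1/2) * pi"
  unfolding A_def by (rule real_sqrt_pow2) (simp add: add_nonneg_nonneg)

lemma node_eq_grid: "node N k = grid (A N) k"
  by (simp add: node_def grid_def A_def)

text \<open>The choice of \<open>A N\<close> makes node \<open>N + 1\<close> coincide with the saddle height, which balances the truncation
  error against the discretisation error.\<close>

lemma grid_shift: "grid (A N) (N + 1 + j) = A N + real j * (pi / A N)"
proof -
  have "A N = (real N + 1/2) * (pi / A N)"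
    using A_square[of N] A_pos[of N] by (simp add: power2_eq_square field_simps)
  moreover have "(real (N + 1 + j) - 1/2) * h = (real N + 1/2) * h + real j * h" for h
    by (simp add: algebra_simps)
  ultimately show ?thesis by (simp only: grid_def)
qed

text \<open>Since \<open>(\<alpha> + j h)\<^sup>2 \<ge> \<alpha>\<^sup>2 + 2\<pi> j\<close>, a geometric series with ratio \<open>q = exp(-2\<pi>)\<close> dominates; and
  \<open>1/(1 - q) \<le> 1 + 1/(2\<pi>)\<close> amounts to \<open>1 + 2\<pi> \<le> exp(2\<pi>)\<close>.\<close>

lemma gaussian_grid_tail_le:
  "(\<Sum>k\<in>{N<..m}. exp (- (grid (A N) k)\<^sup>2)) \<le> (1 + 1 / (2 * pi)) * exp (- (A N)\<^sup>2)"
proof -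
  let ?q = "exp (- (2 * pi))"
  have "(\<Sum>k\<in>{N<..m}. exp (- (grid (A N) k)\<^sup>2)) = (\<Sum>j<m - N. exp (- (grid (A N) (N + 1 + j))\<^sup>2))"
    by (rule sum.reindex_bij_witness[of _ "\<lambda>j. N + 1 + j" "\<lambda>k. k - (N + 1)"]) auto
  also have "\<dots> \<le> (\<Sum>j<m - N. exp (- (A N)\<^sup>2) * ?q ^ j)"
  proof (rule sum_mono)
    fix j
    have "(grid (A N) (N + 1 + j))\<^sup>2 = (A N)\<^sup>2 + 2 * pi * real j + (real j * (pi / A N))\<^sup>2"
      unfolding grid_shift using A_pos[of N] by (simp add: power2_sum)
    then have "exp (- (grid (A N) (N + 1 + j))\<^sup>2) \<le> exp (- (A N)\<^sup>2 + real j * - (2 * pi))"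
      by (simp add: mult_ac)
    then show "exp (- (grid (A N) (N + 1 + j))\<^sup>2) \<le> exp (- (A N)\<^sup>2) * ?q ^ j"
      by (simp only: exp_add exp_of_nat_mult)
  qed
  also have "\<dots> = exp (- (A N)\<^sup>2) * (\<Sum>j<m - N. ?q ^ j)"
    by (simp add: sum_distrib_left)
  also have "(\<Sum>j<m - N. ?q ^ j) = (1 - ?q ^ (m - N)) / (1 - ?q)"
    by (simp add: sum_gp_strict)
  also have "\<dots> \<le> 1 / (1 - ?q)"
    by (intro divide_right_mono) auto
  also have "1 / (1 - ?q) \<le> 1 + 1 / (2 * pi)"
  proof -
    have "(1 + 2 * pi) * ?q \<le> exp (2 * pi) * ?q"
      using exp_ge_add_one_self[of "2 * pi"] by (intro mult_right_mono) auto
    then have "(1 + 2 * pi) * ?q \<le> 1" by (simp flip: exp_add)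
    then show ?thesis by (simp add: field_simps add_pos_pos)
  qed
  finally show ?thesis by (simp add: mult.commute)
qed

lemma fresnel_tail_le:
  assumes "x > 0"
  shows "norm (\<Sum>k\<in>{N<..m}. integrand x (of_real (grid (A N) k))) \<le>
    (1 + 1 / (2 * pi)) * exp (- (A N)\<^sup>2) / sqrt (x^4 + (A N)^4)"
proof -
  have pos: "x^4 + (A N)^4 > 0" using assms by (simp add: add_pos_nonneg)
  have "norm (\<Sum>k\<in>{N<..m}. integrand x (of_real (grid (A N) k))) \<le>
     (\<Sum>k\<in>{N<..m}. exp (- (grid (A N) k)\<^sup>2) / sqrt (x^4 + (A N)^4))"
  proof (rule sum_norm_le)
    fix k assume "k \<in> {N<..m}"
    then have "grid (A N) k \<ge> A N" using grid_shift[of N "k - (N + 1)"] A_pos[of N] by simp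
    then have "(A N)^4 \<le> (grid (A N) k)^4" using A_pos[of N] by (intro power_mono) auto
    then have "sqrt (x^4 + (A N)^4) \<le> sqrt (x^4 + (grid (A N) k)^4)" by simp
    moreover have "norm (integrand x (of_real (grid (A N) k))) = exp (- (grid (A N) k)\<^sup>2) / sqrt (x^4 + (grid (A N) k)^4)"
      by (simp add: integrand_def norm_divide norm_square_plus_i_square Re_power2)
    ultimately show "norm (integrand x (of_real (grid (A N) k))) \<le> exp (- (grid (A N) k)\<^sup>2) / sqrt (x^4 + (A N)^4)"
      using pos by (simp add: divide_left_mono real_sqrt_gt_zero)
  qed
  also have "\<dots> = (\<Sum>k\<in>{N<..m}. exp (- (grid (A N) k)\<^sup>2)) / sqrt (x^4 + (A N)^4)"
    by (simp add: sum_divide_distrib)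
  also have "\<dots> \<le> (1 + 1 / (2 * pi)) * exp (- (A N)\<^sup>2) / sqrt (x^4 + (A N)^4)"
    by (intro divide_right_mono gaussian_grid_tail_le) (use pos in auto)
  finally show ?thesis .
qed

definition midpoint_sum :: "nat \<Rightarrow> real \<Rightarrow> complex" where
  "midpoint_sum N x = of_real (x / A N) * exp (\<i> * of_real (x\<^sup>2 + pi / 4)) *
     (\<Sum>k=1..N. integrand x (of_real (grid (A N) k)))"

lemma fresnel_approx_eq: "fresnel_approx N x = pole_correction (A N) x + midpoint_sum N x"
  unfolding fresnel_approx_def pole_correction_def midpoint_sum_def node_eq_grid integrand_def
  by (simp flip: exp_of_real)

lemma filterlim_box_radius:
  assumes "\<alpha> > 0"
  shows "filterlim (\<lambda>m. real m * (pi / \<alpha>)) at_top sequentially"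
  using assms by (intro filterlim_at_top_mult_tendsto_pos[OF tendsto_const] filterlim_real_sequentially) auto

text \<open>Any bound on the defect that holds in the limit \<open>m \<rightarrow> \<infinity>\<close> yields a bound for the approximation with
  \<open>N\<close> nodes, at the price of the nodes between \<open>N\<close> and \<open>m\<close>.\<close>

lemma fresnel_error_from_defect:
  assumes "x > 0"
    and defect: "\<forall>\<^sub>F m in sequentially. norm (quadrature_defect (A N) x m - 2 * P) \<le>
       2 * B + 6 * A N * exp ((A N)\<^sup>2 - (real m * (pi / A N))\<^sup>2)"
  shows "norm (fresnel_F x - fresnel_prefactor x * (2 * P) - midpoint_sum N x) \<le>
     x / pi * B + (2 * pi + 1) * x / (2 * pi * A N * sqrt (x^4 + (A N)^4)) * exp (- (A N)\<^sup>2)"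
proof -
  let ?\<alpha> = "A N"
  let ?R = "\<lambda>m. real m * (pi / ?\<alpha>)"
  let ?S = "\<lambda>m. \<Sum>k=1..m. integrand x (of_real (grid ?\<alpha> k))"
  let ?K = "\<lambda>m. integral {- ?R m..?R m} (\<lambda>t. integrand x (of_real t))"
  let ?tail = "(2 * pi + 1) * x / (2 * pi * A N * sqrt (x^4 + (A N)^4)) * exp (- (A N)\<^sup>2)"
  have \<alpha>: "?\<alpha> > 0" by (rule A_pos)
  have limR: "filterlim ?R at_top sequentially" by (rule filterlim_box_radius[OF \<alpha>])
  have "?K \<longlonglongrightarrow> whole_line_integral x"
    using filterlim_compose[OF tendsto_whole_line_integral[OF assms(1)] limR] .
  then have 1: "(\<lambda>m. norm (fresnel_prefactor x * ?K m - fresnel_prefactor x * (2 * P) - midpoint_sum N x))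
      \<longlonglongrightarrow> norm (fresnel_F x - fresnel_prefactor x * (2 * P) - midpoint_sum N x)"
    unfolding fresnel_F_eq_whole_line_integral[OF assms(1)] fresnel_prefactor_def[symmetric]
    by (intro tendsto_intros)
  have "((\<lambda>R. x / (2 * pi) * (2 * B + 6 * ?\<alpha> * exp (?\<alpha>\<^sup>2 - R\<^sup>2)) + ?tail) \<longlongrightarrow>
      x / (2 * pi) * (2 * B + 6 * ?\<alpha> * 0) + ?tail) at_top"
  proof (intro tendsto_intros)
    show "((\<lambda>R. exp (?\<alpha>\<^sup>2 - R\<^sup>2)) \<longlongrightarrow> 0) at_top" by real_asymp
  qed
  from filterlim_compose[OF this limR]
  have 2: "(\<lambda>m. x / (2 * pi) * (2 * B + 6 * ?\<alpha> * exp (?\<alpha>\<^sup>2 - (?R m)\<^sup>2)) + ?tail) \<longlonglongrightarrow> x / pi * B + ?tail"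
    by simp
  show ?thesis
  proof (rule tendsto_le[OF _ 2 1])
    show "\<forall>\<^sub>F m in sequentially. norm (fresnel_prefactor x * ?K m - fresnel_prefactor x * (2 * P) - midpoint_sum N x)
        \<le> x / (2 * pi) * (2 * B + 6 * ?\<alpha> * exp (?\<alpha>\<^sup>2 - (?R m)\<^sup>2)) + ?tail"
      using defect eventually_ge_at_top[of N]
    proof eventually_elim
      case (elim m)
      have split: "?S m = ?S N + (\<Sum>k\<in>{N<..m}. integrand x (of_real (grid ?\<alpha> k)))"
      proof -
        have "{1..m} = {1..N} \<union> {N<..m}" using elim(2) by auto
        then show ?thesis by (simp only:) (subst sum.union_disjoint; auto)
      qed
      let ?u = "of_real (x / ?\<alpha>) * exp (\<i> * of_real (x\<^sup>2 + pi / 4)) :: complex"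
      have "fresnel_prefactor x * (2 * of_real (pi / ?\<alpha>)) = ?u"
        using \<alpha> by (simp add: fresnel_prefactor_def field_simps)
      then have "fresnel_prefactor x * (2 * of_real (pi / ?\<alpha>) * ?S m) = ?u * ?S m"
        by (simp only: mult.assoc[symmetric])
      also have "\<dots> = midpoint_sum N x + ?u * (\<Sum>k\<in>{N<..m}. integrand x (of_real (grid ?\<alpha> k)))"
        unfolding split midpoint_sum_def by (simp add: distrib_left)
      finally have "fresnel_prefactor x * ?K m - fresnel_prefactor x * (2 * P) - midpoint_sum N x =
          fresnel_prefactor x * (quadrature_defect ?\<alpha> x m - 2 * P) + ?u * (\<Sum>k\<in>{N<..m}. integrand x (of_real (grid ?\<alpha> k)))"
        unfolding quadrature_defect_def by (simp add: right_diff_distrib)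
      then have "norm (fresnel_prefactor x * ?K m - fresnel_prefactor x * (2 * P) - midpoint_sum N x) \<le>
          norm (fresnel_prefactor x * (quadrature_defect ?\<alpha> x m - 2 * P)) + norm (?u * (\<Sum>k\<in>{N<..m}. integrand x (of_real (grid ?\<alpha> k))))"
        by (simp only: norm_triangle_ineq)
      also have "norm (fresnel_prefactor x * (quadrature_defect ?\<alpha> x m - 2 * P)) \<le>
          x / (2 * pi) * (2 * B + 6 * ?\<alpha> * exp (?\<alpha>\<^sup>2 - (?R m)\<^sup>2))"
        unfolding norm_mult norm_fresnel_prefactor using elim(1) assms(1) by (intro mult_mono) auto
      also have "norm (?u * (\<Sum>k\<in>{N<..m}. integrand x (of_real (grid ?\<alpha> k)))) \<le> ?tail"
      proof -
        have "norm (?u * (\<Sum>k\<in>{N<..m}. integrand x (of_real (grid ?\<alpha> k)))) =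
            x / ?\<alpha> * norm (\<Sum>k\<in>{N<..m}. integrand x (of_real (grid ?\<alpha> k)))"
          using assms(1) \<alpha> by (simp add: norm_mult norm_divide)
        also have "\<dots> \<le> x / ?\<alpha> * ((1 + 1 / (2 * pi)) * exp (- (A N)\<^sup>2) / sqrt (x^4 + (A N)^4))"
          using assms(1) \<alpha> by (intro mult_left_mono fresnel_tail_le) auto
        also have "\<dots> = ?tail"
        proof -
          have "1 + 1 / (2 * pi) = (2 * pi + 1) / (2 * pi)" by (simp add: field_simps)
          then show ?thesis by (simp add: mult_ac)
        qed
        finally show ?thesis .
      qed
      finally show ?case by simp
    qed
  qed simp
qed

section \<open>The error bound\<close>

lemma sqrt_pi_div_pi: "sqrt pi / pi = 1 / sqrt pi"
  using real_div_sqrt[of pi] by (simp add: field_simps)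

text \<open>The detour over the pole contributes at most the part of \<open>Delta\<close> that carries \<open>beta\<close>.  There is
  room to spare, because \<open>beta \<le> 1/16\<close> is well below the exponent \<open>1/4\<close> gained on the detour.\<close>

lemma bump_le:
  assumes "\<alpha> \<ge> 0"
  shows "3 * \<alpha> / 2 * exp (- \<alpha>\<^sup>2 / 4) \<le> 2 * pi * exp (- beta * \<alpha>\<^sup>2)"
proof -
  have b: "beta \<le> 1/16"
  proof -
    have "sqrt 2 \<ge> 7/5" by (rule real_le_rsqrt) (simp add: power2_eq_square)
    then show ?thesis by (simp add: beta_def field_simps)
  qed
  have "3 * \<alpha> / 2 \<le> 2 * 3 * (1 + 3/16 * \<alpha>\<^sup>2)"
  proof -
    have "0 \<le> (\<alpha> - 2/3)\<^sup>2" by simp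
    then show ?thesis by (simp add: power2_eq_square algebra_simps)
  qed
  also have "\<dots> \<le> 2 * pi * exp (3/16 * \<alpha>\<^sup>2)"
    using pi_gt3 exp_ge_add_one_self[of "3/16 * \<alpha>\<^sup>2"] by (intro mult_mono) auto
  also have "\<dots> \<le> 2 * pi * exp (\<alpha>\<^sup>2 / 4 - beta * \<alpha>\<^sup>2)"
    using mult_right_mono[OF b, of "\<alpha>\<^sup>2"] by simp
  finally have "3 * \<alpha> / 2 * exp (- \<alpha>\<^sup>2 / 4) \<le> 2 * pi * exp (\<alpha>\<^sup>2 / 4 - beta * \<alpha>\<^sup>2) * exp (- \<alpha>\<^sup>2 / 4)"
    by (intro mult_right_mono) auto
  also have "\<dots> = 2 * pi * exp (- beta * \<alpha>\<^sup>2)"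
    unfolding mult.assoc exp_add[symmetric] by simp
  finally show ?thesis .
qed

lemma fresnel_error_pos:
  assumes "x > 0"
  shows "norm (fresnel_F x - fresnel_approx N x) \<le> eta N x"
proof -
  define \<alpha> where "\<alpha> = A N"
  define q where "q = 1 - exp (- 2 * \<alpha>\<^sup>2)"
  let ?tail = "(2 * pi + 1) * x / (2 * pi * A N * sqrt (x^4 + (A N)^4)) * exp (- (A N)\<^sup>2)"
  let ?B = "exp (- \<alpha>\<^sup>2) / (q * \<bar>\<alpha>\<^sup>2 - x\<^sup>2 / 2\<bar>) * sqrt pi"
  have \<alpha>: "\<alpha> > 0" unfolding \<alpha>_def by (rule A_pos)
  have q: "q > 0" using \<alpha> by (simp add: q_def)
  have a: "x / sqrt 2 > 0" "(x / sqrt 2)\<^sup>2 = x\<^sup>2 / 2" using assms by (auto simp: power_divide)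
  have ev: "\<forall>\<^sub>F m in sequentially. real m * (pi / \<alpha>) \<ge> x / sqrt 2 + 1 \<and> real m * (pi / \<alpha>) > x / sqrt 2 + \<alpha> / 4"
    using filterlim_box_radius[OF \<alpha>, unfolded filterlim_at_top_dense, rule_format, of "x / sqrt 2 + 1 + \<alpha> / 4"]
    by (rule eventually_mono) (use \<alpha> in linarith)
  have approx: "fresnel_F x - fresnel_approx N x = fresnel_F x - pole_correction \<alpha> x - midpoint_sum N x"
    by (simp add: fresnel_approx_eq \<alpha>_def)
  have B: "x / pi * ?B = x * exp (- \<alpha>\<^sup>2) / (sqrt pi * \<bar>\<alpha>\<^sup>2 - x\<^sup>2 / 2\<bar> * q)"
    using sqrt_pi_div_pi by (simp add: divide_simps)
  have eta: "eta N x = Delta N x + ?tail" using assms by (simp add: eta_def)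
  consider "x / sqrt 2 \<le> 3/4 * \<alpha>" | "3/4 * \<alpha> < x / sqrt 2" "x / sqrt 2 < 5/4 * \<alpha>" | "5/4 * \<alpha> \<le> x / sqrt 2"
    by linarith
  then show ?thesis
  proof cases
    case 1
    have below: "x / sqrt 2 < \<alpha>" by (rule le_less_trans[OF 1]) (use \<alpha> in simp)
    have "norm (fresnel_F x - fresnel_prefactor x * (2 * pole_term \<alpha> x) - midpoint_sum N x) \<le> x / pi * ?B + ?tail"
    proof (rule fresnel_error_from_defect[OF assms])
      show "\<forall>\<^sub>F m in sequentially. norm (quadrature_defect (A N) x m - 2 * pole_term \<alpha> x) \<le>
         2 * ?B + 6 * A N * exp ((A N)\<^sup>2 - (real m * (pi / A N))\<^sup>2)"
        using ev unfolding \<alpha>_def[symmetric]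
      proof eventually_elim
        case (elim m)
        then show ?case unfolding q_def
          by (intro quadrature_defect_pole_below[OF \<alpha> assms below]) auto
      qed
    qed
    moreover have "(x / sqrt 2)\<^sup>2 < \<alpha>\<^sup>2" using below a by (intro power_strict_mono) auto
    ultimately show ?thesis
      using 1 unfolding approx prefactor_pole_term[OF assms] eta B a(2)
      by (simp add: Delta_def q_def \<alpha>_def)
  next
    case 2
    define M where "M = exp (- \<alpha>\<^sup>2) / (q * (\<alpha> / 4 * (\<alpha> + x / sqrt 2)))"
    have M: "M \<ge> 0" using \<alpha> q a by (simp add: M_def)
    let ?C = "M * (sqrt pi + 3 * \<alpha> / 2 * exp (- \<alpha>\<^sup>2 / 4))"
    have "norm (fresnel_F x - fresnel_prefactor x * (2 * pole_term \<alpha> x) - midpoint_sum N x) \<le> x / pi * ?C + ?tail"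
    proof (rule fresnel_error_from_defect[OF assms])
      show "\<forall>\<^sub>F m in sequentially. norm (quadrature_defect (A N) x m - 2 * pole_term \<alpha> x) \<le>
         2 * ?C + 6 * A N * exp ((A N)\<^sup>2 - (real m * (pi / A N))\<^sup>2)"
        using ev unfolding \<alpha>_def[symmetric]
      proof eventually_elim
        case (elim m)
        then show ?case unfolding q_def M_def
          by (intro quadrature_defect_pole_near[OF \<alpha> assms 2]) auto
      qed
    qed
    also have "x / pi * ?C \<le> x / pi * (M * (sqrt pi + 2 * pi * exp (- beta * \<alpha>\<^sup>2)))"
      using assms M bump_le[of \<alpha>] \<alpha> by (intro mult_left_mono add_left_mono) auto
    also have "\<dots> = Delta N x"
    proof -
      have "sqrt pi + 2 * pi * e = sqrt pi * (1 + 2 * sqrt pi * e)" for e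
        by (simp add: distrib_left)
      then have "x / pi * (M * (sqrt pi + 2 * pi * exp (- beta * \<alpha>\<^sup>2))) =
         (sqrt pi / pi) * (x * M * (1 + 2 * sqrt pi * exp (- beta * \<alpha>\<^sup>2)))" by simp
      also have "\<dots> = 4 * x * exp (- \<alpha>\<^sup>2) * (1 + 2 * sqrt pi * exp (- beta * \<alpha>\<^sup>2)) /
        (sqrt pi * \<alpha> * (\<alpha> + x / sqrt 2) * q)"
        unfolding sqrt_pi_div_pi M_def by (simp add: mult_ac)
      also have "\<dots> = Delta N x"
        using 2 unfolding Delta_def q_def \<alpha>_def by simp
      finally show ?thesis .
    qed
    finally show ?thesis unfolding approx prefactor_pole_term[OF assms] eta by simp
  next
    case 3
    have 31: "\<alpha> < x / sqrt 2" by (rule less_le_trans[OF _ 3]) (use \<alpha> in simp)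
    have "norm (fresnel_F x - fresnel_prefactor x * (2 * 0) - midpoint_sum N x) \<le> x / pi * ?B + ?tail"
    proof (rule fresnel_error_from_defect[OF assms])
      show "\<forall>\<^sub>F m in sequentially. norm (quadrature_defect (A N) x m - 2 * 0) \<le>
         2 * ?B + 6 * A N * exp ((A N)\<^sup>2 - (real m * (pi / A N))\<^sup>2)"
        using ev unfolding \<alpha>_def[symmetric]
      proof eventually_elim
        case (elim m)
        then show ?case unfolding q_def
          using quadrature_defect_pole_above[OF \<alpha> assms 31] by simp
      qed
    qed
    moreover have "norm (fresnel_F x - fresnel_approx N x) \<le> norm (fresnel_F x - midpoint_sum N x) + norm (pole_correction \<alpha> x)"
      unfolding approx using norm_triangle_ineq4[of "fresnel_F x - midpoint_sum N x" "pole_correction \<alpha> x"]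
      by (simp add: algebra_simps)
    moreover have "\<alpha>\<^sup>2 < (x / sqrt 2)\<^sup>2" using 31 \<alpha> by (intro power_strict_mono) auto
    ultimately show ?thesis
      using 3 31 \<alpha> norm_pole_correction_le[OF \<alpha> assms] unfolding eta B a(2)
      by (simp add: Delta_def q_def \<alpha>_def)
  qed
qed

lemma fresnel_F_diff:
  assumes "x \<le> y"
  shows "fresnel_F x - fresnel_F y =
    exp (- \<i> * of_real pi / 4) / of_real (sqrt pi) * integral {x..y} (\<lambda>t. exp (\<i> * of_real (t\<^sup>2)))"
proof -
  let ?C = "exp (- \<i> * of_real pi / 4) / of_real (sqrt pi) :: complex"
  let ?I = "\<lambda>u v. integral {u..v} (\<lambda>t. exp (\<i> * complex_of_real (t\<^sup>2)))"
  define z where "z = max y 1"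
  have xz: "x \<le> z" and yz: "y \<le> z" using assms by (auto simp: z_def)
  obtain L where L: "((\<lambda>T. ?I z T) \<longlongrightarrow> L) at_top"
    by (rule that, rule tendsto_chirp_integral) (simp add: z_def)
  have F: "fresnel_F u = ?C * (?I u z + L)" if "u \<le> z" for u
  proof -
    have "((\<lambda>T. ?I u T) \<longlongrightarrow> ?I u z + L) at_top"
    proof (rule Lim_transform_eventually)
      show "((\<lambda>T. ?I u z + ?I z T) \<longlongrightarrow> ?I u z + L) at_top" by (intro tendsto_intros L)
      show "\<forall>\<^sub>F T in at_top. ?I u z + ?I z T = ?I u T"
        using eventually_ge_at_top[of z]
        by eventually_elim
          (rule Henstock_Kurzweil_Integration.integral_combine[OF that _ chirp_integrable])
    qed
    then show ?thesis unfolding fresnel_F_def by (simp add: tendsto_Lim)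
  qed
  have "?I x y + ?I y z = ?I x z"
    using assms by (intro Henstock_Kurzweil_Integration.integral_combine chirp_integrable) (auto simp: z_def)
  then have "?I x z = ?I x y + ?I y z" ..
  then show ?thesis
    unfolding F[OF xz] F[OF yz] by (simp add: distrib_left)
qed

lemma fresnel_F_diff_le:
  assumes "x \<le> y"
  shows "norm (fresnel_F x - fresnel_F y) \<le> (y - x) / sqrt pi"
proof -
  have "norm (integral {x..y} (\<lambda>t. exp (\<i> * complex_of_real (t\<^sup>2)))) \<le> 1 * (y - x)"
    by (rule integral_bound) (use assms in \<open>auto simp del: of_real_power intro!: continuous_intros\<close>)
  moreover have "norm (exp (- \<i> * of_real pi / 4)) = 1"
    using norm_exp_i_times[of "- pi / 4"] by simp
  ultimately show ?thesis
    unfolding fresnel_F_diff[OF assms] norm_mult norm_divide by (simp add: divide_right_mono)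
qed

text \<open>As \<open>x\<close> decreases to \<open>0\<close> the error bound tends to \<open>0\<close> and the approximation to \<open>1/2\<close>; any fixed
  number of nodes will do, here one.\<close>

lemma fresnel_F_zero: "fresnel_F 0 = 1/2"
proof -
  let ?\<alpha> = "A 1"
  have \<alpha>: "?\<alpha> > 0" by (rule A_pos)
  let ?q = "1 - exp (- 2 * ?\<alpha>\<^sup>2)"
  have q: "?q > 0" using \<alpha> by simp
  define bound where "bound = (\<lambda>x. x / sqrt pi + (x * exp (- ?\<alpha>\<^sup>2) / (sqrt pi * (?\<alpha>\<^sup>2 - x\<^sup>2 / 2) * ?q)
     + (2 * pi + 1) * \<bar>x\<bar> / (2 * pi * ?\<alpha> * sqrt (x^4 + ?\<alpha>^4)) * exp (- ?\<alpha>\<^sup>2)))"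
  have "(fresnel_approx 1 \<longlongrightarrow> 1/2) (at_right 0)"
  proof -
    have "(pole_correction ?\<alpha> \<longlongrightarrow> 1 / (exp (2 * of_real ?\<alpha> * of_real 0 * exp (- \<i> * of_real pi / 4)) + 1)) (at_right 0)"
      unfolding pole_correction_def by (intro tendsto_intros) simp
    moreover have "(midpoint_sum 1 \<longlongrightarrow> of_real (0 / ?\<alpha>) * exp (\<i> * of_real (0\<^sup>2 + pi / 4)) *
        (\<Sum>k=1..1. exp (- (of_real (grid ?\<alpha> k))\<^sup>2) / (of_real (0\<^sup>2) + \<i> * (of_real (grid ?\<alpha> k))\<^sup>2))) (at_right 0)"
      unfolding midpoint_sum_def integrand_def using \<alpha> by (intro tendsto_intros) (auto simp: grid_def)
    ultimately have "((\<lambda>x. pole_correction ?\<alpha> x + midpoint_sum 1 x) \<longlongrightarrow> 1/2 + 0) (at_right 0)"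
      by (intro tendsto_add) simp_all
    then show ?thesis by (simp add: fresnel_approx_eq[abs_def])
  qed
  then have 1: "((\<lambda>x. norm (fresnel_F 0 - fresnel_approx 1 x)) \<longlongrightarrow> norm (fresnel_F 0 - 1/2)) (at_right 0)"
    by (intro tendsto_intros)
  have 2: "(bound \<longlongrightarrow> 0) (at_right 0)"
  proof -
    have "(bound \<longlongrightarrow> 0 / sqrt pi + (0 * exp (- ?\<alpha>\<^sup>2) / (sqrt pi * (?\<alpha>\<^sup>2 - 0\<^sup>2 / 2) * ?q)
       + (2 * pi + 1) * \<bar>0\<bar> / (2 * pi * ?\<alpha> * sqrt (0^4 + ?\<alpha>^4)) * exp (- ?\<alpha>\<^sup>2))) (at_right 0)"
      unfolding bound_def using \<alpha> by (intro tendsto_intros) auto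
    then show ?thesis by simp
  qed
  have "norm (fresnel_F 0 - 1/2) \<le> 0"
  proof (rule tendsto_le[OF _ 2 1])
    have "\<forall>\<^sub>F x in at_right 0. x < ?\<alpha> / 2"
      using \<alpha> by (intro eventually_at_right_real[of 0 "?\<alpha> / 2", THEN eventually_mono]) auto
    then show "\<forall>\<^sub>F x in at_right 0. norm (fresnel_F 0 - fresnel_approx 1 x) \<le> bound x"
      using eventually_at_right_less[of 0]
    proof eventually_elim
      case (elim x)
      have "x / sqrt 2 \<le> x" using elim by (simp add: divide_le_eq)
      then have "x / sqrt 2 \<le> 3/4 * ?\<alpha>" using elim by linarith
      then have "eta 1 x = bound x - x / sqrt pi"
        using elim unfolding eta_def Delta_def bound_def by simp
      moreover have "norm (fresnel_F 0 - fresnel_F x) \<le> x / sqrt pi"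
        using fresnel_F_diff_le[of 0 x] elim by simp
      moreover have "norm (fresnel_F 0 - fresnel_approx 1 x) \<le> norm (fresnel_F 0 - fresnel_F x) + norm (fresnel_F x - fresnel_approx 1 x)"
        using norm_triangle_ineq[of "fresnel_F 0 - fresnel_F x" "fresnel_F x - fresnel_approx 1 x"] by simp
      ultimately show ?case using fresnel_error_pos[of x 1] elim by linarith
    qed
  qed simp
  then show ?thesis by simp
qed

lemma fresnel_F_minus:
  assumes "x \<ge> 0"
  shows "fresnel_F (- x) = 1 - fresnel_F x"
proof -
  have "integral {-x..0} (\<lambda>t. exp (\<i> * complex_of_real (t\<^sup>2))) = integral {0..x} (\<lambda>t. exp (\<i> * complex_of_real (t\<^sup>2)))"
    using Henstock_Kurzweil_Integration.integral_reflect_real[of x 0 "\<lambda>t. exp (\<i> * complex_of_real (t\<^sup>2))"] by simp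
  then have "fresnel_F (- x) - fresnel_F 0 = fresnel_F 0 - fresnel_F x"
    using fresnel_F_diff[of "-x" 0] fresnel_F_diff[of 0 x] assms by simp
  then have "fresnel_F (- x) = (fresnel_F 0 + fresnel_F 0) - fresnel_F x" by (simp add: algebra_simps)
  then show ?thesis unfolding fresnel_F_zero by simp
qed

lemma fresnel_approx_minus:
  assumes "x > 0"
  shows "fresnel_approx N (- x) = 1 - fresnel_approx N x"
proof -
  have "pole_correction (A N) (- x) = 1 - pole_correction (A N) x"
  proof -
    have "1 + exp (- 2 * \<i> * of_real (A N) * integrand_pole x) \<noteq> 0"
      using assms by (intro kernel_denominator_nz_upper A_pos) (simp add: integrand_pole_def)
    moreover have "integrand_pole (- x) = - integrand_pole x"
      by (simp add: integrand_pole_def complex_eq_iff)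
    ultimately show ?thesis
      using midpoint_kernel_minus by (simp flip: midpoint_kernel_integrand_pole)
  qed
  moreover have "midpoint_sum N (- x) = - midpoint_sum N x"
    by (simp add: midpoint_sum_def integrand_def)
  ultimately show ?thesis by (simp add: fresnel_approx_eq)
qed

lemma eta_minus: "eta N (- x) = eta N x"
  by (simp add: eta_def)

theorem fresnel_error: "norm (fresnel_F x - fresnel_approx N x) \<le> eta N x"
proof -
  consider "x > 0" | "x = 0" | "- x > 0" by linarith
  then show ?thesis
  proof cases
    case 1
    then show ?thesis by (rule fresnel_error_pos)
  next
    case 2
    have "fresnel_approx N 0 = 1/2"
      by (simp add: fresnel_approx_def)
    then show ?thesis using A_pos[of N] by (simp add: 2 fresnel_F_zero eta_def Delta_def)
  next
    case 3
    have "fresnel_F x - fresnel_approx N x = - (fresnel_F (- x) - fresnel_approx N (- x))"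
      using fresnel_F_minus[of "- x"] fresnel_approx_minus[of "- x"] 3 by simp
    then show ?thesis
      using fresnel_error_pos[OF 3, of N] eta_minus[of N x] by (simp add: norm_minus_commute)
  qed
qed

section \<open>The uniform bound\<close>

lemma sqrt2_bounds: "1.41421 \<le> sqrt 2" "sqrt 2 \<le> 1.41422"
proof -
  show "1.41421 \<le> sqrt 2" by (rule real_le_rsqrt) (simp add: power2_eq_square)
  show "sqrt 2 \<le> 1.41422" by (rule real_le_lsqrt) (simp_all add: power2_eq_square)
qed

lemma beta_eq: "beta = 15/16 - 5/8 * sqrt 2"
  by (simp add: beta_def field_simps)

lemma beta_bounds: "0.0536125 \<le> beta" "beta \<le> 0.05361875"
  using sqrt2_bounds by (simp_all add: beta_eq)

text \<open>Because \<open>(A N)\<^sup>2 = (N + 1/2) \<pi>\<close>, the rate \<open>exp(-\<pi> N) / \<surd>(N + 1/2)\<close> is a multiple of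
  \<open>exp(-(A N)\<^sup>2) / A N\<close>.\<close>

lemma c_scaled:
  fixes N :: nat
  defines "\<alpha> \<equiv> A N"
  shows "c N * (exp (- pi * real N) / sqrt (real N + 1/2)) =
    20 * sqrt 2 * exp (- \<alpha>\<^sup>2) * (1 + 2 * sqrt pi * exp (- beta * \<alpha>\<^sup>2)) / (9 * sqrt pi * \<alpha> * (1 - exp (- 2 * \<alpha>\<^sup>2)))
    + (2 * pi + 1) * exp (- \<alpha>\<^sup>2) / (2 * sqrt 2 * pi * \<alpha>\<^sup>2)"
proof -
  define s p where "s = sqrt (real N + 1/2)" and "p = sqrt pi"
  have \<alpha>: "\<alpha> = s * p" by (simp add: \<alpha>_def A_def s_def p_def real_sqrt_mult)
  have sp: "s > 0" "p > 0" by (simp_all add: s_def p_def add_nonneg_pos)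
  have pi: "pi = p * p" by (simp add: p_def)
  have E: "exp (- \<alpha>\<^sup>2) = exp (- pi / 2) * exp (- pi * real N)"
    unfolding \<alpha>_def A_square by (simp add: algebra_simps flip: exp_add)
  have pw: "pi powr (3/2) = pi * p"
  proof -
    have "pi powr (1 + 1/2) = pi powr 1 * pi powr (1/2)" by (rule powr_add)
    then show ?thesis by (simp add: p_def powr_half_sqrt)
  qed
  let ?X = "1 + 2 * sqrt pi * exp (- beta * \<alpha>\<^sup>2)" and ?q = "1 - exp (- 2 * \<alpha>\<^sup>2)"
  have 1: "20 * sqrt 2 * e / (9 * pi * ?q) * ?X * (n / s) = 20 * sqrt 2 * (e * n) * ?X / (9 * sqrt pi * \<alpha> * ?q)" for e n
    unfolding \<alpha>[symmetric] using sp by (simp add: \<alpha> pi flip: p_def) (simp add: pi[symmetric] mult_ac)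
  have 2: "(2 * pi + 1) * e / (2 * sqrt 2 * pi powr (3/2) * \<alpha>) * (n / s) = (2 * pi + 1) * (e * n) / (2 * sqrt 2 * pi * \<alpha>\<^sup>2)" for e n
    unfolding pw power2_eq_square using sp by (simp add: \<alpha> mult_ac)
  show ?thesis
    unfolding c_def \<alpha>_def[symmetric] s_def[symmetric] by (subst distrib_right) (simp only: 1 2 E)
qed

text \<open>With \<open>\<alpha> = A N\<close> and \<open>a = x/\<surd>2\<close>, the first two branches increase in \<open>a\<close> and the third decreases, so each is
  largest at its end nearest to \<open>5\<alpha>/4\<close>.  The second branch and the rational summand of the third, taken at
  \<open>a = 5\<alpha>/4\<close>, give the factor \<open>20\<surd>2/9\<close>; the first stays below it.  The exponential summand of the third branch is absorbed
  by the term with \<open>beta\<close>.\<close>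

lemma Delta_le:
  fixes N :: nat and x :: real
  assumes "x \<ge> 0"
  defines "\<alpha> \<equiv> A N"
  shows "Delta N x \<le> 20 * sqrt 2 * exp (- \<alpha>\<^sup>2) * (1 + 2 * sqrt pi * exp (- beta * \<alpha>\<^sup>2)) / (9 * sqrt pi * \<alpha> * (1 - exp (- 2 * \<alpha>\<^sup>2)))"
proof -
  define a where "a = x / sqrt 2"
  define q where "q = 1 - exp (- 2 * \<alpha>\<^sup>2)"
  define e where "e = exp (- beta * \<alpha>\<^sup>2)"
  have x: "x = sqrt 2 * a" "x\<^sup>2 / 2 = a\<^sup>2" "a \<ge> 0" using assms by (auto simp: a_def power_divide)
  have \<alpha>: "\<alpha> > 0" unfolding \<alpha>_def by (rule A_pos)
  have q: "q > 0" "q < 1" using \<alpha> by (simp_all add: q_def)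
  let ?k = "exp (- \<alpha>\<^sup>2) / (sqrt pi * q)"
  let ?X = "1 + 2 * sqrt pi * e"
  have e: "e \<ge> 0" by (simp add: e_def)
  have X: "?X \<ge> 1" using e by simp
  have k: "?k \<ge> 0" using q by simp
  have goal: "20 * sqrt 2 * exp (- \<alpha>\<^sup>2) * ?X / (9 * sqrt pi * \<alpha> * q) = ?k * (sqrt 2 * (20 / (9 * \<alpha>))) * ?X"
    using q \<alpha> by (simp add: field_simps)
  have R: "sqrt 2 * (20 / (9 * \<alpha>)) \<ge> 0" using \<alpha> by simp
  consider "a \<le> 3/4 * \<alpha>" | "3/4 * \<alpha> < a" "a < 5/4 * \<alpha>" | "5/4 * \<alpha> \<le> a" by linarith
  then have "Delta N x \<le> ?k * (sqrt 2 * (20 / (9 * \<alpha>))) * ?X"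
  proof cases
    case 1
    have "a\<^sup>2 \<le> (3/4 * \<alpha>)\<^sup>2" using 1 x by (intro power_mono) auto
    then have d: "7/16 * \<alpha>\<^sup>2 \<le> \<alpha>\<^sup>2 - a\<^sup>2" by (simp add: power2_eq_square algebra_simps)
    have dp: "\<alpha>\<^sup>2 - a\<^sup>2 > 0" by (rule less_le_trans[OF _ d]) (use \<alpha> in simp)
    have "9 * \<alpha> * a \<le> 20 * (\<alpha>\<^sup>2 - a\<^sup>2)"
    proof -
      have "9 * \<alpha> * a \<le> 9 * \<alpha> * (3/4 * \<alpha>)" using 1 \<alpha> by (intro mult_left_mono) auto
      also have "\<dots> \<le> 20 * (7/16 * \<alpha>\<^sup>2)" by (simp add: power2_eq_square)
      also have "\<dots> \<le> 20 * (\<alpha>\<^sup>2 - a\<^sup>2)" using d by (rule mult_left_mono) simp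
      finally show ?thesis .
    qed
    then have "a / (\<alpha>\<^sup>2 - a\<^sup>2) \<le> 20 / (9 * \<alpha>)" using \<alpha> dp by (simp add: divide_simps mult_ac)
    then have "?k * (sqrt 2 * (a / (\<alpha>\<^sup>2 - a\<^sup>2))) \<le> ?k * (sqrt 2 * (20 / (9 * \<alpha>)))"
      using k by (intro mult_left_mono) auto
    also have "\<dots> \<le> ?k * (sqrt 2 * (20 / (9 * \<alpha>))) * ?X"
      using mult_left_mono[OF X mult_nonneg_nonneg[OF k R]] by simp
    finally have "?k * (sqrt 2 * (a / (\<alpha>\<^sup>2 - a\<^sup>2))) \<le> ?k * (sqrt 2 * (20 / (9 * \<alpha>))) * ?X" .
    moreover have "Delta N x = ?k * (sqrt 2 * (a / (\<alpha>\<^sup>2 - a\<^sup>2)))"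
      using 1 x(2) unfolding Delta_def a_def[symmetric] \<alpha>_def[symmetric] q_def[symmetric] by (simp add: x(1) mult_ac)
    ultimately show ?thesis by simp
  next
    case 2
    have "4 * a / (\<alpha> * (\<alpha> + a)) \<le> 20 / (9 * \<alpha>)"
      using 2 \<alpha> x(3) by (simp add: divide_simps)
    then have "?k * (sqrt 2 * (4 * a / (\<alpha> * (\<alpha> + a)))) * ?X \<le> ?k * (sqrt 2 * (20 / (9 * \<alpha>))) * ?X"
      using k X by (intro mult_right_mono mult_left_mono) auto
    moreover have "Delta N x = ?k * (sqrt 2 * (4 * a / (\<alpha> * (\<alpha> + a)))) * ?X"
      using 2 unfolding Delta_def a_def[symmetric] \<alpha>_def[symmetric] q_def[symmetric] e_def[symmetric] by (simp add: x(1) mult_ac)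
    ultimately show ?thesis by simp
  next
    case 3
    have "\<alpha> < 5/4 * \<alpha>" using \<alpha> by simp
    then have a\<alpha>: "\<alpha> < a" using 3 by linarith
    have dp: "a\<^sup>2 - \<alpha>\<^sup>2 > 0" using a\<alpha> \<alpha> by (simp add: power_strict_mono)
    \<comment> \<open>This product is \<open>20 (a\<^sup>2 - \<alpha>\<^sup>2) - 9 \<alpha> a\<close>.\<close>
    have "0 \<le> (a - 5/4 * \<alpha>) * (20 * a + 16 * \<alpha>)" using 3 \<alpha> x by (intro mult_nonneg_nonneg) auto
    then have "9 * \<alpha> * a \<le> 20 * (a\<^sup>2 - \<alpha>\<^sup>2)" by (simp add: power2_eq_square algebra_simps)
    then have "a / (a\<^sup>2 - \<alpha>\<^sup>2) \<le> 20 / (9 * \<alpha>)" using \<alpha> dp by (simp add: divide_simps mult_ac)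
    then have D1: "?k * (sqrt 2 * (a / (a\<^sup>2 - \<alpha>\<^sup>2))) \<le> ?k * (sqrt 2 * (20 / (9 * \<alpha>)))"
      using k by (intro mult_left_mono) auto
    define r where "r = exp (- sqrt 2 * \<alpha> * x)"
    have "(5/4 * \<alpha>) * \<alpha> \<le> a * \<alpha>" using 3 \<alpha> by (intro mult_right_mono) auto
    moreover have "sqrt 2 * \<alpha> * x = 2 * (a * \<alpha>)" by (simp add: x(1))
    moreover have "5/2 * \<alpha>\<^sup>2 = 2 * ((5/4 * \<alpha>) * \<alpha>)" by (simp add: power2_eq_square)
    ultimately have ax: "5/2 * \<alpha>\<^sup>2 \<le> sqrt 2 * \<alpha> * x" by linarith
    have r1: "r \<le> exp (- (5/2 * \<alpha>\<^sup>2))" using ax by (simp add: r_def)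
    have r2: "q \<le> 1 - r" using ax by (simp add: q_def r_def) (smt (verit) zero_le_power2)
    have "\<alpha> * exp (- (5/2 * \<alpha>\<^sup>2)) \<le> exp (- \<alpha>\<^sup>2) * e"
    proof -
      have "beta * \<alpha>\<^sup>2 \<le> 1/2 * \<alpha>\<^sup>2" using beta_bounds by (intro mult_right_mono) auto
      have "\<alpha> \<le> 1 + \<alpha>\<^sup>2" using sum_squares_bound[of \<alpha> 1] \<alpha> by (simp add: power2_eq_square)
      also have "\<dots> \<le> exp (\<alpha>\<^sup>2)" by (rule exp_ge_add_one_self)
      finally have "\<alpha> * exp (- (5/2 * \<alpha>\<^sup>2)) \<le> exp (\<alpha>\<^sup>2) * exp (- (5/2 * \<alpha>\<^sup>2))"
        by (intro mult_right_mono) auto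
      also have "\<dots> \<le> exp (- \<alpha>\<^sup>2) * e"
        using \<open>beta * \<alpha>\<^sup>2 \<le> 1/2 * \<alpha>\<^sup>2\<close> unfolding e_def exp_add[symmetric] by simp
      finally show ?thesis .
    qed
    then have r3: "exp (- (5/2 * \<alpha>\<^sup>2)) \<le> exp (- \<alpha>\<^sup>2) * e / \<alpha>" using \<alpha> by (simp add: field_simps)
    have "0 < 1 - r" using r2 q by linarith
    moreover have "0 \<le> r" by (simp add: r_def)
    ultimately have "r / (1 - r) \<le> r / q" using r2 q by (intro divide_left_mono mult_pos_pos)
    also have "\<dots> \<le> (exp (- \<alpha>\<^sup>2) * e / \<alpha>) / q" using r1 r3 q by (intro divide_right_mono) auto
    also have "\<dots> \<le> (exp (- \<alpha>\<^sup>2) * e / \<alpha>) / q * (40 * sqrt 2 / 9)"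
    proof -
      have "1 \<le> 40 * sqrt 2 / 9" using sqrt2_bounds by simp
      then show ?thesis using mult_left_mono[of 1 "40 * sqrt 2 / 9" "(exp (- \<alpha>\<^sup>2) * e / \<alpha>) / q"] q e \<alpha> by simp
    qed
    also have "\<dots> = ?k * (sqrt 2 * (20 / (9 * \<alpha>))) * (2 * sqrt pi * e)" using \<alpha> q by (simp add: field_simps)
    finally have D2: "r / (1 - r) \<le> ?k * (sqrt 2 * (20 / (9 * \<alpha>))) * (2 * sqrt pi * e)" .
    have "Delta N x = ?k * (sqrt 2 * (a / (a\<^sup>2 - \<alpha>\<^sup>2))) + r / (1 - r)"
    proof -
      have "\<not> a \<le> 3/4 * \<alpha>" "\<not> a < 5/4 * \<alpha>" using a\<alpha> \<alpha> 3 by auto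
      then show ?thesis
        unfolding Delta_def a_def[symmetric] \<alpha>_def[symmetric] q_def[symmetric] r_def[symmetric] x(2)
        by (simp add: x(1) mult_ac)
    qed
    then show ?thesis using D1 D2 unfolding distrib_left[of _ 1] by simp
  qed
  then show ?thesis unfolding goal[symmetric] by (simp only: q_def e_def)
qed

text \<open>The truncation term is largest where \<open>x\<^sup>4 + \<alpha>\<^sup>4 \<ge> 2 x\<^sup>2 \<alpha>\<^sup>2\<close> is an equality, at \<open>|x| = \<alpha>\<close>.\<close>

lemma eta_le: "eta N x \<le> c N * (exp (- pi * real N) / sqrt (real N + 1/2))"
proof -
  define \<alpha> where "\<alpha> = A N"
  have \<alpha>: "\<alpha> > 0" unfolding \<alpha>_def by (rule A_pos)
  have pos: "x^4 + \<alpha>^4 > 0" using \<alpha> by (simp add: add_nonneg_pos)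
  have "sqrt 2 * \<bar>x\<bar> * \<alpha> \<le> sqrt (x^4 + \<alpha>^4)"
  proof (rule real_le_rsqrt)
    have "0 \<le> (x\<^sup>2 - \<alpha>\<^sup>2)\<^sup>2" by simp
    then show "(sqrt 2 * \<bar>x\<bar> * \<alpha>)\<^sup>2 \<le> x^4 + \<alpha>^4"
      by (simp add: power_mult_distrib power2_diff flip: power_mult)
  qed
  then have "\<bar>x\<bar> / sqrt (x^4 + \<alpha>^4) \<le> 1 / (sqrt 2 * \<alpha>)"
    using \<alpha> pos by (simp add: divide_simps mult_ac)
  then have "(2 * pi + 1) / (2 * pi * \<alpha>) * exp (- \<alpha>\<^sup>2) * (\<bar>x\<bar> / sqrt (x^4 + \<alpha>^4)) \<le>
      (2 * pi + 1) / (2 * pi * \<alpha>) * exp (- \<alpha>\<^sup>2) * (1 / (sqrt 2 * \<alpha>))"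
    using \<alpha> by (intro mult_left_mono) auto
  then have "(2 * pi + 1) * \<bar>x\<bar> / (2 * pi * \<alpha> * sqrt (x^4 + \<alpha>^4)) * exp (- \<alpha>\<^sup>2) \<le>
      (2 * pi + 1) * exp (- \<alpha>\<^sup>2) / (2 * sqrt 2 * pi * \<alpha>\<^sup>2)"
    by (simp add: power2_eq_square mult_ac)
  then show ?thesis
    unfolding c_scaled eta_def \<alpha>_def[symmetric] using Delta_le[of "\<bar>x\<bar>" N] by (simp flip: \<alpha>_def)
qed

section \<open>Monotonicity, limit and numerical values of the constant\<close>

lemma c_strict_decreasing:
  assumes "M < N"
  shows "c N < c M"
proof -
  have AA: "A M < A N" using assms by (simp add: A_def)
  then have sq: "(A M)\<^sup>2 \<le> (A N)\<^sup>2" using A_pos[of M] by (intro power_mono) auto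
  have q: "0 < 1 - exp (- 2 * (A M)\<^sup>2)" using A_pos[of M] by simp
  have b: "beta * (A M)\<^sup>2 \<le> beta * (A N)\<^sup>2" using beta_bounds sq by (intro mult_left_mono) auto
  have q': "0 < 1 - exp (- 2 * (A N)\<^sup>2)" using A_pos[of N] by simp
  have "20 * sqrt 2 * exp (- pi / 2) / (9 * pi * (1 - exp (- 2 * (A N)\<^sup>2))) \<le>
     20 * sqrt 2 * exp (- pi / 2) / (9 * pi * (1 - exp (- 2 * (A M)\<^sup>2)))"
    using sq q q' by (intro divide_left_mono mult_left_mono mult_pos_pos) auto
  then have "20 * sqrt 2 * exp (- pi / 2) / (9 * pi * (1 - exp (- 2 * (A N)\<^sup>2))) * (1 + 2 * sqrt pi * exp (- beta * (A N)\<^sup>2)) \<le>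
     20 * sqrt 2 * exp (- pi / 2) / (9 * pi * (1 - exp (- 2 * (A M)\<^sup>2))) * (1 + 2 * sqrt pi * exp (- beta * (A M)\<^sup>2))"
    using b q by (intro mult_mono add_left_mono mult_left_mono) auto
  moreover have "(2 * pi + 1) * exp (- pi / 2) / (2 * sqrt 2 * pi powr (3/2) * A N) <
     (2 * pi + 1) * exp (- pi / 2) / (2 * sqrt 2 * pi powr (3/2) * A M)"
    using AA A_pos[of M] A_pos[of N] by (intro divide_strict_left_mono mult_strict_left_mono mult_pos_pos add_pos_pos) auto
  ultimately show ?thesis unfolding c_def by linarith
qed

lemma filterlim_A: "filterlim A at_top sequentially"
proof -
  have "filterlim (\<lambda>N. real N + 1/2) at_top sequentially"
    by real_asymp
  then have "filterlim (\<lambda>N. (real N + 1/2) * pi) at_top sequentially"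
    by (intro filterlim_at_top_mult_tendsto_pos[OF tendsto_const]) auto
  then show ?thesis
    unfolding A_def[abs_def] by (rule filterlim_compose[OF sqrt_at_top])
qed

lemma c_limit: "c \<longlonglongrightarrow> 20 * sqrt 2 * exp (- pi / 2) / (9 * pi)"
proof -
  have b: "beta > 0" using beta_bounds by simp
  have 1: "((\<lambda>y::real. exp (- 2 * y\<^sup>2)) \<longlongrightarrow> 0) at_top" by real_asymp
  have 2: "((\<lambda>y::real. exp (- beta * y\<^sup>2)) \<longlongrightarrow> 0) at_top" using b by real_asymp
  have 3: "((\<lambda>y::real. (2 * pi + 1) * exp (- pi / 2) / (2 * sqrt 2 * pi powr (3/2) * y)) \<longlongrightarrow> 0) at_top" by real_asymp
  have "((\<lambda>y. 20 * sqrt 2 * exp (- pi / 2) / (9 * pi * (1 - exp (- 2 * y\<^sup>2))) * (1 + 2 * sqrt pi * exp (- beta * y\<^sup>2))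
     + (2 * pi + 1) * exp (- pi / 2) / (2 * sqrt 2 * pi powr (3/2) * y)) \<longlongrightarrow>
     20 * sqrt 2 * exp (- pi / 2) / (9 * pi * (1 - 0)) * (1 + 2 * sqrt pi * 0) + 0) at_top"
    by (intro tendsto_intros 1 2 3) auto
  from filterlim_compose[OF this filterlim_A] show ?thesis
    by (simp add: c_def[abs_def])
qed

text \<open>The Lagrange remainder of even order is nonnegative for arguments of either sign, so one inequality
  serves for lower bounds of \<open>exp(-x)\<close> directly and for upper bounds through the reciprocal of
  \<open>exp x\<close>.\<close>

lemma exp_ge_even_Taylor:
  fixes x :: real
  assumes "even n"
  shows "(\<Sum>m<n. x ^ m / fact m) \<le> exp x"
proof -
  obtain t where "exp x = (\<Sum>m<n. x ^ m / fact m) + exp t / fact n * x ^ n"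
    using Maclaurin_exp_le[of x n] by auto
  moreover have "exp t / fact n * x ^ n \<ge> 0" using assms by (intro mult_nonneg_nonneg zero_le_even_power) auto
  ultimately show ?thesis by linarith
qed

lemma exp_minus_le_even_Taylor:
  fixes x :: real
  assumes "even n" "0 < (\<Sum>m<n. x ^ m / fact m)"
  shows "exp (- x) \<le> 1 / (\<Sum>m<n. x ^ m / fact m)"
  using exp_ge_even_Taylor[OF assms(1), of x] assms(2) by (simp add: exp_minus field_simps)

lemma exp_minus_half_pi_bounds: "0.20787 \<le> exp (- pi / 2)" "exp (- pi / 2) \<le> 0.20789"
proof -
  have "0.20787 \<le> (\<Sum>m<12. (- 1.5708 :: real) ^ m / fact m)"
    by (simp add: eval_nat_numeral fact_numeral)
  also have "\<dots> \<le> exp (- 1.5708)" by (rule exp_ge_even_Taylor) simp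
  also have "\<dots> \<le> exp (- pi / 2)" using pi_approx by simp
  finally show "0.20787 \<le> exp (- pi / 2)" .
  have "exp (- pi / 2) \<le> exp (- 1.57079)" using pi_approx by simp
  also have "\<dots> \<le> 1 / (\<Sum>m<12. (1.57079 :: real) ^ m / fact m)"
    by (rule exp_minus_le_even_Taylor, simp) (simp add: eval_nat_numeral fact_numeral)
  also have "\<dots> \<le> 0.20789" by (simp add: eval_nat_numeral fact_numeral)
  finally show "exp (- pi / 2) \<le> 0.20789" .
qed

lemma pi_bounds: "3.14159 \<le> pi" "pi \<le> 3.1416"
  using pi_approx by auto

lemma c_limit_approx: "\<bar>20 * sqrt 2 * exp (- pi / 2) / (9 * pi) - 0.208\<bar> \<le> 0.0005"
proof -
  let ?n = "sqrt 2 * exp (- pi / 2)"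
  have "1.41421 * 0.20787 \<le> ?n" using sqrt2_bounds exp_minus_half_pi_bounds by (intro mult_mono) auto
  moreover have "?n \<le> 1.41422 * 0.20789" using sqrt2_bounds exp_minus_half_pi_bounds by (intro mult_mono) auto
  ultimately have "0.2075 * (9 * pi) \<le> 20 * ?n" "20 * ?n \<le> 0.2085 * (9 * pi)"
    using pi_bounds by auto
  then have "0.2075 \<le> 20 * ?n / (9 * pi)" "20 * ?n / (9 * pi) \<le> 0.2085"
    by (simp_all add: field_simps)
  moreover have "\<bar>y - 0.208\<bar> \<le> 0.0005" if "0.2075 \<le> y" "y \<le> 0.2085" for y :: real
    using that by (auto simp: abs_if)
  ultimately show ?thesis unfolding mult.assoc by blast
qed

lemma c_1_approx: "\<bar>c 1 - 0.825\<bar> \<le> 0.0005"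
proof -
  define u q w where "u = exp (- pi / 2)" and "q = exp (- 2 * (A 1)\<^sup>2)" and "w = exp (- beta * (A 1)\<^sup>2)"
  have u: "0.20787 \<le> u" "u \<le> 0.20789" unfolding u_def by (rule exp_minus_half_pi_bounds)+
  have A1: "(A 1)\<^sup>2 = 3/2 * pi" by (simp add: A_square)
  have s: "1.77245 \<le> sqrt pi" "sqrt pi \<le> 1.77246"
    by (rule real_le_rsqrt real_le_lsqrt; use pi_approx in \<open>simp add: power2_eq_square\<close>)+
  have s3: "1.73205 \<le> sqrt 3" "sqrt 3 \<le> 1.73206"
    by (rule real_le_rsqrt real_le_lsqrt; simp add: power2_eq_square)+
  have q: "0 < q" "q \<le> 0.00017"
  proof -
    have "q \<le> exp (- 9)" using pi_gt3 unfolding q_def A1 by simp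
    also have "exp (- 9 :: real) = exp (- 3) ^ 3" by (simp flip: exp_of_nat_mult)
    also have "\<dots> \<le> (1 / 18.4) ^ 3"
    proof (rule power_mono)
      have "exp (- 3 :: real) \<le> 1 / (\<Sum>m<6. 3 ^ m / fact m)"
        by (rule exp_minus_le_even_Taylor, simp) (simp add: eval_nat_numeral fact_numeral)
      also have "\<dots> \<le> 1 / 18.4" by (simp add: eval_nat_numeral fact_numeral)
      finally show "exp (- 3 :: real) \<le> 1 / 18.4" .
    qed simp
    also have "\<dots> \<le> 0.00017" by (simp add: power_divide)
    finally show "q \<le> 0.00017" .
  qed (simp add: q_def)
  have w: "0.7767 \<le> w" "w \<le> 0.7768"
  proof -
    have l: "0.2526 \<le> beta * (3/2 * pi)"
      using mult_mono[OF beta_bounds(1), of "3/2 * 3.14159" "3/2 * pi"] pi_bounds beta_bounds by simp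
    have r: "beta * (3/2 * pi) \<le> 0.2527"
      using mult_mono[OF beta_bounds(2), of "3/2 * pi" "3/2 * 3.1416"] pi_bounds beta_bounds by simp
    have "0.7767 \<le> (\<Sum>m<6. (- 0.2527 :: real) ^ m / fact m)"
      by (simp add: eval_nat_numeral fact_numeral)
    also have "\<dots> \<le> exp (- 0.2527)" by (rule exp_ge_even_Taylor) simp
    also have "\<dots> \<le> w" using r unfolding w_def A1 by simp
    finally show "0.7767 \<le> w" .
    have "w \<le> exp (- 0.2526)" using l unfolding w_def A1 by simp
    also have "\<dots> \<le> 1 / (\<Sum>m<6. (0.2526 :: real) ^ m / fact m)"
      by (rule exp_minus_le_even_Taylor, simp) (simp add: eval_nat_numeral fact_numeral)
    also have "\<dots> \<le> 0.7768" by (simp add: eval_nat_numeral fact_numeral)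
    finally show "w \<le> 0.7768" .
  qed
  have A1': "A 1 = sqrt (3/2) * sqrt pi" unfolding A_def by (simp flip: real_sqrt_mult)
  have pw: "pi powr (3/2) = pi * sqrt pi"
  proof -
    have "pi powr (1 + 1/2) = pi powr 1 * pi powr (1/2)" by (rule powr_add)
    then show ?thesis by (simp add: powr_half_sqrt)
  qed
  have den: "2 * sqrt 2 * pi powr (3/2) * A 1 = 2 * sqrt 3 * pi\<^sup>2"
  proof -
    have "sqrt 2 * sqrt (3/2) = sqrt 3" by (simp flip: real_sqrt_mult)
    then have "2 * sqrt 2 * pi powr (3/2) * A 1 = 2 * sqrt 3 * pi * (sqrt pi * sqrt pi)"
      unfolding A1' pw by (simp only: mult_ac)
    then show ?thesis by (simp add: power2_eq_square)
  qed
  have c1: "c 1 = 20 * sqrt 2 * u / (9 * pi * (1 - q)) * (1 + 2 * sqrt pi * w) + (2 * pi + 1) * u / (2 * sqrt 3 * pi\<^sup>2)"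
    unfolding c_def u_def[symmetric] q_def[symmetric] w_def[symmetric] den ..
  have "20 * 1.41421 * 0.20787 / (9 * 3.1416 * 1) * (1 + 2 * 1.77245 * 0.7767) + (2 * 3.14159 + 1) * 0.20787 / (2 * 1.73206 * 3.1416\<^sup>2) \<le> c 1"
    unfolding c1 using u q w s s3 sqrt2_bounds pi_bounds
    by (intro add_mono mult_mono frac_le power_mono) auto
  moreover have "c 1 \<le> 20 * 1.41422 * 0.20789 / (9 * 3.14159 * (1 - 0.00017)) * (1 + 2 * 1.77246 * 0.7768) + (2 * 3.1416 + 1) * 0.20789 / (2 * 1.73205 * 3.14159\<^sup>2)"
    unfolding c1 using u q w s s3 sqrt2_bounds pi_bounds
    by (intro add_mono mult_mono frac_le power_mono) auto
  ultimately show ?thesis by (auto simp: abs_if power2_eq_square)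
qed

theorem theorem3:
  shows "(\<forall>N::nat. N \<ge> 1 \<longrightarrow> (\<forall>x::real.
             cmod (fresnel_F x - fresnel_approx N x) \<le> eta N x \<and>
             eta N x \<le> c N * (exp (- pi * real N) / sqrt (real N + 1/2))))
       \<and> (\<forall>M N::nat. 1 \<le> M \<and> M < N \<longrightarrow> c N < c M)
       \<and> \<bar>c 1 - 0.825\<bar> \<le> 0.0005
       \<and> c \<longlonglongrightarrow> 20 * sqrt 2 * exp (- pi / 2) / (9 * pi)
       \<and> \<bar>20 * sqrt 2 * exp (- pi / 2) / (9 * pi) - 0.208\<bar> \<le> 0.0005"
  using fresnel_error eta_le c_strict_decreasing c_1_approx c_limit c_limit_approx by blast

end
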